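(* Let $V_{1}, \ldots, V_{n}$ be a finite collection of closed subsets of $\mathbb{R}^{2}$, each homeomorphic to the closed two-dimensional disk. Suppose that the set $\bigcup_{i=1}^{n} \operatorname{Int} V_{i}$ is connected. Let $W$ be the unbounded connected component of the set $\mathbb{R}^{2} \setminus \bigcup_{i=1}^{n} V_{i}$. Then the set $\mathbb{R}^{2} \setminus W$ is homeomorphic to the closed two-dimensional disk.
   Context: $\operatorname{Int} V_i$ denotes the interior of $V_i$ in $\mathbb{R}^2$. Since $\bigcup_i V_i$ is compact, the complement $\mathbb{R}^{2} \setminus \bigcup_{i} V_{i}$ has exactly one unbounded connected component. *)

theory Defs
  imports "HOL-Analysis.Analysis"
begin

end

theory Submission
  imports Defs "HOL-Complex_Analysis.Complex_Analysis"
begin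

text \<open>
  Let \<open>K\<close> be the union of the \<open>V i\<close>. It is locally connected, and since the union of the interiors
  is connected, open and dense in \<open>K\<close>, no point (and no pair of points) separates \<open>K\<close>.
  Inverting at a point \<open>c\<close> of this open set turns \<open>W \<union> {\<infinity>}\<close> into a bounded simply connected
  domain \<open>G\<close>. Caratheodory's argument applies to its Riemann map: small crosscuts
  (length-area method), completed by small connected pieces of the locally connected boundary,
  cut off small pieces of \<open>G\<close> (Janiszewski's theorem), so the map extends continuously
  to the closed disc. If two boundary points had the same image \<open>p\<close>, the images of the two radii would form
  a Jordan curve meeting \<open>K\<close> only in \<open>p\<close>; as \<open>K - {p}\<close> is connected, one side of the curve contains
  no point of \<open>K\<close>, and the map would be constant on an arc of the circle.
  Hence the frontier of \<open>W\<close> is a Jordan curve, \<open>-W\<close> is its closed inside, and the same argument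
  applied to the inside of the curve gives the homeomorphism.
\<close>

unbundle no fps_syntax

section \<open>The length-area method\<close>

text \<open>Lebesgue measure is determined by its values on boxes, and the coordinate map sends
  boxes to boxes of the same area. This form gives access to the Jacobian change of variables on
  \<open>real^2\<close>; the form with pairs below gives access to Tonelli.\<close>

lemma lborel_complex_vec2:
  "distr (lborel :: (real^2) measure) borel (\<lambda>v. Complex (v$1) (v$2)) = lborel"
proof (rule lborel_eqI[symmetric])
  show "sets (distr (lborel :: (real^2) measure) borel (\<lambda>v. Complex (v$1) (v$2))) = sets borel"
    by simp
  fix l u :: complex
  assume le: "\<And>b. b \<in> Basis \<Longrightarrow> l \<bullet> b \<le> u \<bullet> b"
  have leR: "Re l \<le> Re u" "Im l \<le> Im u"
    using le[of 1] le[of \<i>] by (auto simp: Basis_complex_def)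
  define a b :: "real^2" where "a = vector [Re l, Im l]" and "b = vector [Re u, Im u]"
  have meas: "(\<lambda>v::real^2. Complex (v$1) (v$2)) \<in> borel_measurable borel"
    by (intro borel_measurable_continuous_onI)
       (auto intro!: continuous_intros simp: Complex_eq)
  have "emeasure (distr lborel borel (\<lambda>v::real^2. Complex (v$1) (v$2))) (box l u)
      = emeasure lborel ((\<lambda>v::real^2. Complex (v$1) (v$2)) -` box l u \<inter> space lborel)"
    by (rule emeasure_distr) (use meas in \<open>simp_all\<close>)
  also have "(\<lambda>v::real^2. Complex (v$1) (v$2)) -` box l u \<inter> space lborel = box a b"
    by (auto simp: a_def b_def mem_box_cart in_box_complex_iff forall_2)
  also have "emeasure lborel (box a b) = ennreal (\<Prod>i\<in>UNIV. b $ i - a $ i)"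
  proof -
    have B: "(Basis :: (real^2) set) = {axis 1 1, axis 2 1}"
      by (auto simp: Basis_vec_def UNIV_2)
    moreover have "axis 1 1 \<noteq> (axis 2 1 :: real^2)"
      by (simp add: axis_eq_axis)
    ultimately show ?thesis
      using leR unfolding emeasure_lborel_box_eq B
      by (simp add: a_def b_def inner_axis UNIV_2)
  qed
  also have "\<dots> = (\<Prod>b\<in>Basis. (u - l) \<bullet> b)"
    by (simp add: UNIV_2 Basis_complex_def a_def b_def)
  finally show "emeasure (distr (lborel :: (real^2) measure) borel (\<lambda>v. Complex (v$1) (v$2))) (box l u) = ennreal (\<Prod>b\<in>Basis. (u - l) \<bullet> b)" .
qed

lemma lborel_complex_prod:
  "distr (lborel :: (real\<times>real) measure) borel (\<lambda>(x,y). Complex x y) = lborel"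
proof (rule lborel_eqI[symmetric])
  show "sets (distr (lborel :: (real\<times>real) measure) borel (\<lambda>(x,y). Complex x y)) = sets borel"
    by simp
  fix l u :: complex
  assume le: "\<And>b. b \<in> Basis \<Longrightarrow> l \<bullet> b \<le> u \<bullet> b"
  have leR: "Re l \<le> Re u" "Im l \<le> Im u"
    using le[of 1] le[of \<i>] by (auto simp: Basis_complex_def)
  have meas: "(\<lambda>(x,y). Complex x y) \<in> borel_measurable borel"
    by (intro borel_measurable_continuous_onI)
       (auto intro!: continuous_intros simp: Complex_eq case_prod_unfold)
  have "emeasure (distr lborel borel (\<lambda>(x,y). Complex x y)) (box l u)
      = emeasure lborel ((\<lambda>(x,y). Complex x y) -` box l u \<inter> space lborel)"
    by (intro emeasure_distr) (use meas in \<open>simp_all\<close>)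
  also have "(\<lambda>(x,y). Complex x y) -` box l u \<inter> space lborel = box (Re l, Im l) (Re u, Im u)"
    by (auto simp: box_prod in_box_complex_iff)
  also have "emeasure lborel \<dots> = ennreal (\<Prod>b\<in>Basis. (u - l) \<bullet> b)"
    using leR by (subst emeasure_lborel_box) (auto simp: Basis_complex_def Basis_prod_def prod.union_disjoint)
  finally show "emeasure (distr (lborel :: (real\<times>real) measure) borel (\<lambda>(x,y). Complex x y)) (box l u) = ennreal (\<Prod>b\<in>Basis. (u - l) \<bullet> b)" .
qed

lemma nn_integral_complex_iterated:
  fixes f :: "complex \<Rightarrow> ennreal"
  assumes [measurable]: "f \<in> borel_measurable borel"
  shows "(\<integral>\<^sup>+z. f z \<partial>lborel) = (\<integral>\<^sup>+x. \<integral>\<^sup>+y. f (Complex x y) \<partial>lborel \<partial>lborel)"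
proof -
  have meas[measurable]: "(\<lambda>(x,y). Complex x y) \<in> borel_measurable borel"
    by (intro borel_measurable_continuous_onI)
       (auto intro!: continuous_intros simp: Complex_eq case_prod_unfold)
  have "(\<integral>\<^sup>+z. f z \<partial>lborel) = (\<integral>\<^sup>+p. f (case p of (x,y) \<Rightarrow> Complex x y) \<partial>(lborel \<Otimes>\<^sub>M lborel))"
    by (subst lborel_complex_prod[symmetric], subst nn_integral_distr) (auto simp: lborel_prod)
  also have "\<dots> = (\<integral>\<^sup>+x. \<integral>\<^sup>+y. f (Complex x y) \<partial>lborel \<partial>lborel)"
    by (subst lborel.nn_integral_fst[symmetric]) (auto simp: lborel_prod)
  finally show ?thesis .
qed

lemma borel_measurable_nn_integral_vertical:
  fixes f :: "complex \<Rightarrow> ennreal"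
  assumes [measurable]: "f \<in> borel_measurable borel"
  shows "(\<lambda>x. \<integral>\<^sup>+y. f (Complex x y) \<partial>lborel) \<in> borel_measurable borel"
proof (rule lborel.borel_measurable_nn_integral)
  have [measurable]: "(\<lambda>(x,y). Complex x y) \<in> borel_measurable borel"
    by (intro borel_measurable_continuous_onI)
       (auto intro!: continuous_intros simp: Complex_eq case_prod_unfold)
  have "(\<lambda>p. f (case p of (x,y) \<Rightarrow> Complex x y)) \<in> borel_measurable borel"
    by measurable
  moreover have "sets (borel \<Otimes>\<^sub>M lborel) = sets (borel :: (real \<times> real) measure)"
    by (subst borel_prod[symmetric]) (intro sets_pair_measure_cong, auto)
  ultimately show "(\<lambda>(x, y). f (Complex x y)) \<in> borel_measurable (borel \<Otimes>\<^sub>M lborel)"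
    by (simp add: case_prod_unfold cong: measurable_cong_sets)
qed

lemma borel_measurable_ennreal_times_indicator:
  fixes f :: "'a::topological_space \<Rightarrow> real"
  assumes "open S" "continuous_on S f"
  shows "(\<lambda>x. ennreal (f x) * indicator S x) \<in> borel_measurable borel"
proof -
  have "(\<lambda>x. ennreal (f x) * indicator S x) = (\<lambda>x. ennreal (indicator S x *\<^sub>R f x))"
    by (auto split: split_indicator)
  also have "\<dots> \<in> borel_measurable borel"
    using borel_measurable_continuous_on_indicator[OF _ assms(2)] assms(1)
    by (intro measurable_compose[OF _ measurable_ennreal]) auto
  finally show ?thesis .
qed

section \<open>Area and energy of conformal maps\<close>

text \<open>The real Jacobian of a holomorphic map is the squared modulus of its derivative, so this
  is the change of variables formula for an injective map, transported to \<open>real^2\<close> by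
  \<open>C\<close> and \<open>R\<close>.\<close>

lemma nn_integral_deriv_eq_area:
  fixes g :: "complex \<Rightarrow> complex"
  assumes Q: "open Q" and g: "g holomorphic_on Q" and inj: "inj_on g Q"
    and bd: "bounded (g ` Q)"
  shows "(\<integral>\<^sup>+z. ennreal ((cmod (deriv g z))\<^sup>2) * indicator Q z \<partial>lborel) = emeasure lborel (g ` Q)"
proof -
  define C where "C = (\<lambda>v::real^2. Complex (v$1) (v$2))"
  define R where "R = (\<lambda>z. vector [Re z, Im z] :: real^2)"
  have CR: "C (R z) = z" for z by (simp add: C_def R_def)
  have RC: "R (C v) = v" for v by (simp add: C_def R_def vec_eq_iff forall_2)
  have blC: "bounded_linear C" unfolding C_def
    by (intro linear_conv_bounded_linear[THEN iffD1] linearI) (auto simp: complex_eq_iff)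
  have blR: "bounded_linear R" unfolding R_def
    by (intro linear_conv_bounded_linear[THEN iffD1] linearI) (auto simp: vec_eq_iff forall_2)
  have cC: "continuous_on X C" for X using blC linear_continuous_on by blast
  have cR: "continuous_on X R" for X using blR linear_continuous_on by blast
  have [measurable]: "C \<in> borel_measurable borel" using cC borel_measurable_continuous_onI by blast
  have gQ: "open (g ` Q)" using open_mapping_thm3[OF g Q inj] .
  define S where "S = C -` Q"
  have S: "open S" unfolding S_def by (intro open_vimage Q cC)
  define f where "f = R \<circ> g \<circ> C"
  define f' where "f' = (\<lambda>v. R \<circ> (\<lambda>h. deriv g (C v) * h) \<circ> C)"
  have der: "(f has_derivative f' v) (at v within S)" if "v \<in> S" for v
  proof -
    have "(g has_field_derivative deriv g (C v)) (at (C v))"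
      using g Q that S_def holomorphic_derivI by blast
    then have "(g has_derivative (\<lambda>h. deriv g (C v) * h)) (at (C v))"
      by (simp add: has_field_derivative_def)
    then have "(f has_derivative f' v) (at v)" unfolding f_def f'_def
      by (intro diff_chain_at bounded_linear_imp_has_derivative blC blR)
    then show ?thesis using has_derivative_at_withinI by blast
  qed
  \<comment> \<open>In real coordinates, multiplication by \<open>a + \<i> b\<close> has the matrix
    with rows \<open>(a, -b)\<close> and \<open>(b, a)\<close>, of determinant
    \<open>a^2 + b^2\<close>.\<close>
  have det: "\<bar>det (matrix (f' v))\<bar> = (cmod (deriv g (C v)))\<^sup>2" for v
    by (simp add: det_2 matrix_def f'_def C_def R_def axis_def cmod_power2)
       (simp add: power2_eq_square)
  have injf: "inj_on f S" using inj unfolding f_def inj_on_def S_def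
    by (metis CR RC comp_apply vimageE)
  have fS: "f ` S = C -` (g ` Q)"
  proof (intro equalityI subsetI)
    fix v assume "v \<in> f ` S" then show "v \<in> C -` (g ` Q)" by (auto simp: f_def S_def CR)
  next
    fix v assume "v \<in> C -` (g ` Q)"
    then obtain z where "z \<in> Q" "C v = g z" by auto
    then show "v \<in> f ` S" unfolding f_def S_def
      by (intro image_eqI[of _ _ "R z"]) (simp_all add: CR, metis RC)
  qed
  have ofS: "open (f ` S)" unfolding fS by (intro open_vimage gQ cC)
  have eqm: "emeasure lborel (g ` Q) = emeasure lborel (f ` S)"
    unfolding fS using gQ
    by (subst lborel_complex_vec2[symmetric]) (simp add: C_def[symmetric] emeasure_distr)
  have cder: "continuous_on Q (\<lambda>z. (cmod (deriv g z))\<^sup>2)"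
    by (intro continuous_intros holomorphic_on_imp_continuous_on holomorphic_deriv g Q)
  have [measurable]: "(\<lambda>z. ennreal ((cmod (deriv g z))\<^sup>2) * indicator Q z) \<in> borel_measurable borel"
    by (rule borel_measurable_ennreal_times_indicator[OF Q cder])
  have "(\<integral>\<^sup>+z. ennreal ((cmod (deriv g z))\<^sup>2) * indicator Q z \<partial>lborel)
      = (\<integral>\<^sup>+v. ennreal ((cmod (deriv g (C v)))\<^sup>2) * indicator Q (C v) \<partial>lborel)"
    by (subst lborel_complex_vec2[symmetric], subst nn_integral_distr)
       (use \<open>C \<in> _\<close> in \<open>simp_all add: C_def\<close>)
  also have "\<dots> = (\<integral>\<^sup>+v. ennreal (indicator S v * \<bar>det (matrix (f' v))\<bar>) \<partial>lborel)"
    by (intro nn_integral_cong) (auto simp: det S_def split: split_indicator)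
  also have "\<dots> = emeasure lborel (f ` S)"
  proof -
    have "f ` S = R ` (g ` Q)"
      unfolding f_def S_def image_comp[symmetric] using CR by (metis surj_def surj_image_vimage_eq)
    then have "bounded (f ` S)"
      using bd bounded_linear_image blR by metis
    then have lm: "f ` S \<in> lmeasurable"
      using ofS lmeasurable_open by blast
    have "((\<lambda>v. \<bar>det (matrix (f' v))\<bar>) has_integral measure lebesgue (f ` S)) S"
      using has_measure_differentiable_image[OF _ der injf] lm S by auto
    then have "(\<integral>\<^sup>+v. ennreal (indicator S v * \<bar>det (matrix (f' v))\<bar>) \<partial>lborel) = measure lebesgue (f ` S)"
      by (intro nn_integral_has_integral_lebesgue) auto
    also have "\<dots> = emeasure lebesgue (f ` S)"
      using lm by (simp add: emeasure_eq_measure2)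
    also have "\<dots> = emeasure lborel (f ` S)"
      using ofS by (simp add: emeasure_completion)
    finally show ?thesis .
  qed
  finally show ?thesis using eqm by simp
qed

text \<open>Cauchy-Schwarz on a vertical segment: the distance of the end images is at most the
  integral of the modulus of the derivative, whose square is at most length times energy.\<close>

lemma dist_squared_le_energy:
  fixes g :: "complex \<Rightarrow> complex"
  assumes Q: "open Q" and g: "g holomorphic_on Q" and "y1 \<le> y2"
    and seg: "\<And>y. y1 \<le> y \<Longrightarrow> y \<le> y2 \<Longrightarrow> Complex s y \<in> Q"
  shows "ennreal ((dist (g (Complex s y1)) (g (Complex s y2)))\<^sup>2) \<le>
    ennreal (y2 - y1) * (\<integral>\<^sup>+y. ennreal ((cmod (deriv g (Complex s y)))\<^sup>2) * indicator Q (Complex s y) \<partial>lborel)"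
proof (cases "dist (g (Complex s y1)) (g (Complex s y2)) = 0")
  case False
  define d where "d = dist (g (Complex s y1)) (g (Complex s y2))"
  have d: "d > 0" using False d_def by simp
  have y12: "y1 < y2" using False \<open>y1 \<le> y2\<close> by (cases "y1 = y2") auto
  define M where "M = y2 - y1"
  have M: "M > 0" using y12 M_def by simp
  have cder: "continuous_on Q (deriv g)"
    by (intro holomorphic_on_imp_continuous_on holomorphic_deriv g Q)
  have cC: "continuous_on X (Complex s)" for X
    by (auto intro!: continuous_intros simp: Complex_eq)
  have cg: "continuous_on {y1..y2} (\<lambda>y. deriv g (Complex s y))"
    by (rule continuous_on_compose2[OF cder cC]) (use seg in auto)
  define e where "e = (\<lambda>y. (cmod (deriv g (Complex s y)))\<^sup>2)"
  have ce: "continuous_on {y1..y2} e" unfolding e_def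
    by (intro continuous_intros cg)
  define I where "I = integral {y1..y2} e"
  have eI: "(e has_integral I) {y1..y2}"
    unfolding I_def by (intro integrable_integral integrable_continuous_real ce)
  have I0: "I \<ge> 0" using has_integral_nonneg[OF eI] e_def by auto
  \<comment> \<open>Cauchy-Schwarz in additive form: the inequality of arithmetic and geometric
    means gives \<open>cmod (deriv g _) \<le> k y\<close>. With the weight \<open>M / d\<close>,
    integration yields \<open>d \<le> (M * I / d + d) / 2\<close>, which is
    \<open>d^2 \<le> M * I\<close>.\<close>
  define k where "k = (\<lambda>y. (M / d * e y + d / M) / 2)"
  have kI: "(k has_integral ((M / d * I + d / M * (y2 - y1)) / 2)) {y1..y2}"
    unfolding k_def using y12
    by (intro has_integral_divide has_integral_add has_integral_mult_right eI)
       (use has_integral_const_real[of "d/M" y1 y2] in \<open>simp add: mult.commute\<close>)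
  have vd: "((\<lambda>y. g (Complex s y)) has_vector_derivative (\<i> * deriv g (Complex s y))) (at y within {y1..y2})"
    if "y \<in> {y1..y2}" for y
  proof -
    have "(g has_field_derivative deriv g (Complex s y)) (at (Complex s y))"
      using g Q seg that holomorphic_derivI by auto
    moreover have "((\<lambda>y. Complex s y) has_vector_derivative \<i>) (at y within {y1..y2})"
      unfolding Complex_eq by (auto intro!: derivative_eq_intros)
    ultimately show ?thesis
      using field_vector_diff_chain_within[of "Complex s" \<i> y "{y1..y2}" g "deriv g (Complex s y)"]
        has_field_derivative_at_within by (simp add: o_def) blast
  qed
  have hi: "((\<lambda>y. \<i> * deriv g (Complex s y)) has_integral (g (Complex s y2) - g (Complex s y1))) {y1..y2}"
    using fundamental_theorem_of_calculus[OF \<open>y1 \<le> y2\<close> vd] by simp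
  have "d = norm (integral {y1..y2} (\<lambda>y. \<i> * deriv g (Complex s y)))"
    using hi by (simp only: integral_unique d_def dist_norm norm_minus_commute)
  also have "\<dots> \<le> integral {y1..y2} k"
  proof (rule integral_norm_bound_integral)
    fix y assume "y \<in> {y1..y2}"
    define c where "c = cmod (deriv g (Complex s y))"
    have "0 \<le> (c - d / M)\<^sup>2" by simp
    then have "2 * (d / M) * c \<le> c\<^sup>2 + (d / M)\<^sup>2" by (simp add: power2_diff algebra_simps)
    then have "c \<le> k y" using d M unfolding k_def e_def c_def[symmetric]
      by (simp add: field_simps power2_eq_square)
    then show "cmod (\<i> * deriv g (Complex s y)) \<le> k y" by (simp add: norm_mult c_def)
  qed (use hi kI in auto)
  also have "\<dots> = (M / d * I + d / M * (y2 - y1)) / 2"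
    using kI by (rule integral_unique)
  finally have "d\<^sup>2 \<le> M * I" using d M unfolding M_def[symmetric]
    by (simp add: field_simps power2_eq_square)
  then have "ennreal (d\<^sup>2) \<le> ennreal M * ennreal I"
    using M I0 by (simp flip: ennreal_mult)
  also have "ennreal I = (\<integral>\<^sup>+y. ennreal (indicator {y1..y2} y * e y) \<partial>lborel)"
    using eI by (intro nn_integral_has_integral_lebesgue[symmetric]) (auto simp: e_def)
  also have "\<dots> \<le> (\<integral>\<^sup>+y. ennreal ((cmod (deriv g (Complex s y)))\<^sup>2) * indicator Q (Complex s y) \<partial>lborel)"
    by (intro nn_integral_mono) (auto simp: e_def seg split: split_indicator)
  finally show ?thesis unfolding d_def M_def by (simp add: mult_left_mono)
qed auto

text \<open>If the image of every arc of radius below \<open>r0\<close> had two points more than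
  \<open>e\<close> apart, each of these arcs would carry energy at least \<open>e^2 / pi\<close> in
  the logarithmic coordinate. Logarithmic radii fill a half-line of infinite length, so the total
  would exceed the finite area of the image.\<close>

lemma length_area_small_crosscut:
  fixes \<phi> :: "complex \<Rightarrow> complex"
  assumes hol: "\<phi> holomorphic_on ball 0 1" and inj: "inj_on \<phi> (ball 0 1)"
    and bd: "bounded (\<phi> ` ball 0 1)" and a: "cmod a = 1" and e: "e > 0" and r0: "r0 > 0"
  shows "\<exists>r>0. r < r0 \<and>
    (\<forall>z \<in> ball 0 1 \<inter> sphere a r. \<forall>w \<in> ball 0 1 \<inter> sphere a r. dist (\<phi> z) (\<phi> w) \<le> e)"
proof (rule ccontr)
  assume neg: "\<not> ?thesis"
  have a0: "a \<noteq> 0" using a by auto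
  \<comment> \<open>\<open>T\<close> maps vertical lines to circles about \<open>a\<close>, so Fubini in Cartesian coordinates suffices.\<close>
  define T where "T = (\<lambda>\<zeta>. a * (1 - exp \<zeta>))"
  define Q where "Q = {\<zeta>. \<bar>Im \<zeta>\<bar> < pi/2 \<and> cmod (1 - exp \<zeta>) < 1}"
  define g where "g = \<phi> \<circ> T"
  have Q: "open Q" unfolding Q_def
    by (intro open_Collect_conj open_Collect_less continuous_intros)
  have TQ: "T ` Q \<subseteq> ball 0 1" using a by (auto simp: T_def Q_def norm_mult)
  have hT: "T holomorphic_on Q" unfolding T_def by (intro holomorphic_intros)
  have hg: "g holomorphic_on Q" unfolding g_def
    using holomorphic_on_compose_gen[OF hT hol TQ] .
  have injT: "inj_on T Q"
  proof (rule inj_onI)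
    fix x y assume xy: "x \<in> Q" "y \<in> Q" "T x = T y"
    have "exp x = exp y"
      using xy(3) a0 unfolding T_def mult_cancel_left by simp
    moreover have "\<bar>Im x\<bar> < pi/2" "\<bar>Im y\<bar> < pi/2"
      using xy(1,2) unfolding Q_def by blast+
    then have "\<bar>Im x - Im y\<bar> < 2 * pi"
      using pi_gt_zero by linarith
    ultimately show "x = y" by (rule exp_complex_eqI[rotated])
  qed
  have injg: "inj_on g Q" unfolding g_def
    using injT inj TQ by (intro comp_inj_on) (auto intro: inj_on_subset)
  have bg: "bounded (g ` Q)"
    by (rule bounded_subset[OF bd]) (use TQ in \<open>auto simp: g_def\<close>)
  define A where "A = measure lborel (g ` Q)"
  have A: "emeasure lborel (g ` Q) = ennreal A"
    unfolding A_def by (intro emeasure_eq_ennreal_measure)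
      (use emeasure_bounded_finite[OF bg] in auto)
  \<comment> \<open>Each vertical slice of \<open>Q\<close> is an interval symmetric about 0 and of
    length at most \<open>pi\<close>, since the condition says that \<open>cos y\<close> exceeds
    \<open>exp s / 2\<close>. Two points of a slice are therefore joined by a vertical segment
    inside \<open>Q\<close>.\<close>
  have slice: "Complex s y \<in> Q \<longleftrightarrow> \<bar>y\<bar> < pi/2 \<and> exp s < 2 * cos y" for s y
  proof -
    have "(cmod (1 - exp (Complex s y)))\<^sup>2 = (1 - exp s * cos y)\<^sup>2 + (exp s * sin y)\<^sup>2"
      by (simp add: cmod_power2 Re_exp Im_exp)
    also have "\<dots> = 1 + exp s * (exp s - 2 * cos y)"
      using sin_cos_squared_add[of y] by algebra
    finally have eq: "(cmod (1 - exp (Complex s y)))\<^sup>2 = 1 + exp s * (exp s - 2 * cos y)" .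
    have "cmod (1 - exp (Complex s y)) < 1 \<longleftrightarrow> (cmod (1 - exp (Complex s y)))\<^sup>2 < 1"
      by (simp add: abs_square_less_1)
    also have "\<dots> \<longleftrightarrow> exp s < 2 * cos y"
      unfolding eq by (simp add: mult_less_0_iff)
    finally show ?thesis by (simp add: Q_def)
  qed
  define F where "F = (\<lambda>s. \<integral>\<^sup>+y. ennreal ((cmod (deriv g (Complex s y)))\<^sup>2) * indicator Q (Complex s y) \<partial>lborel)"
  have low: "ennreal (e\<^sup>2) \<le> ennreal pi * F s" if s: "s < ln r0" for s
  proof -
    have "0 < exp s" "exp s < r0" using s r0 exp_less_mono[OF s] by simp_all
    then obtain z w where zw: "z \<in> ball 0 1 \<inter> sphere a (exp s)" "w \<in> ball 0 1 \<inter> sphere a (exp s)"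
        "dist (\<phi> z) (\<phi> w) > e"
      using neg by (metis linorder_not_le)
    have pt: "\<exists>y. Complex s y \<in> Q \<and> T (Complex s y) = z" if z: "z \<in> ball 0 1 \<inter> sphere a (exp s)" for z
    proof -
      define \<zeta> where "\<zeta> = 1 - z / a"
      have n: "cmod \<zeta> = exp s"
      proof -
        have "cmod \<zeta> = cmod ((a - z) / a)" using a0 by (simp add: \<zeta>_def diff_divide_distrib)
        also have "\<dots> = exp s" using a z by (simp add: norm_divide dist_norm)
        finally show ?thesis .
      qed
      have \<zeta>0: "\<zeta> \<noteq> 0" using n by auto
      have l1: "cmod (1 - \<zeta>) < 1" using z a by (simp add: \<zeta>_def norm_divide)
      have "Re \<zeta> > 0"
        using l1 abs_Re_le_cmod[of "1 - \<zeta>"] by auto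
      then have "\<bar>Im (Ln \<zeta>)\<bar> < pi/2" using Re_Ln_pos_lt_imp by auto
      moreover have "Ln \<zeta> = Complex s (Im (Ln \<zeta>))"
        using \<zeta>0 n by (simp add: complex_eq_iff)
      moreover have "T (Ln \<zeta>) = z" using \<zeta>0 a0 by (simp add: T_def \<zeta>_def)
      moreover have "Ln \<zeta> \<in> Q" using \<zeta>0 l1 calculation(1) by (simp add: Q_def)
      ultimately show ?thesis by metis
    qed
    have ord: "ennreal (e\<^sup>2) \<le> ennreal pi * F s"
      if y: "y1 \<le> y2" "Complex s y1 \<in> Q" "Complex s y2 \<in> Q"
        and d: "e < dist (g (Complex s y1)) (g (Complex s y2))" for y1 y2
    proof -
      have b: "\<bar>y1\<bar> < pi/2" "\<bar>y2\<bar> < pi/2" "exp s < 2 * cos y1" "exp s < 2 * cos y2"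
        using y slice by auto
      have seg: "Complex s y \<in> Q" if "y1 \<le> y" "y \<le> y2" for y
      proof -
        \<comment> \<open>A number between \<open>y1\<close> and \<open>y2\<close> is no larger in
          absolute value than one of them, and \<open>cos\<close> is even and decreasing on
          \<open>[0, pi]\<close>.\<close>
        have "\<bar>y\<bar> \<le> \<bar>y1\<bar> \<or> \<bar>y\<bar> \<le> \<bar>y2\<bar>" using that by linarith
        then have "cos \<bar>y1\<bar> \<le> cos \<bar>y\<bar> \<or> cos \<bar>y2\<bar> \<le> cos \<bar>y\<bar>"
          using b by (elim disj_forward; intro cos_monotone_0_pi_le) linarith+
        then show ?thesis using b that by (auto simp: slice)
      qed
      have "ennreal (e\<^sup>2) \<le> ennreal ((dist (g (Complex s y1)) (g (Complex s y2)))\<^sup>2)"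
        using d e by (intro ennreal_leI power_mono) auto
      also have "\<dots> \<le> ennreal (y2 - y1) * F s"
        unfolding F_def by (rule dist_squared_le_energy[OF Q hg y(1) seg])
      also have "\<dots> \<le> ennreal pi * F s"
        using b by (intro mult_right_mono ennreal_leI) auto
      finally show ?thesis .
    qed
    obtain y1 where y1: "Complex s y1 \<in> Q" "T (Complex s y1) = z" using pt[OF zw(1)] by blast
    obtain y2 where y2: "Complex s y2 \<in> Q" "T (Complex s y2) = w" using pt[OF zw(2)] by blast
    show ?thesis
      using ord[of y1 y2] ord[of y2 y1] y1 y2 zw(3) by (cases "y1 \<le> y2") (auto simp: g_def dist_commute)
  qed
  have cder: "continuous_on Q (\<lambda>z. (cmod (deriv g z))\<^sup>2)"
    by (intro continuous_intros holomorphic_on_imp_continuous_on holomorphic_deriv hg Q)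
  have [measurable]: "(\<lambda>z. ennreal ((cmod (deriv g z))\<^sup>2) * indicator Q z) \<in> borel_measurable borel"
    by (rule borel_measurable_ennreal_times_indicator[OF Q cder])
  \<comment> \<open>Length of an interval of logarithmic radii on which the lower bound from
    \<open>low\<close> already integrates to \<open>pi * A + 1\<close>, more than the total
    \<open>pi * A\<close>.\<close>
  define N where "N = (pi * A + 1) / e\<^sup>2"
  have A0: "A \<ge> 0" by (simp add: A_def)
  have N0: "N \<ge> 0" using A0 e by (simp add: N_def)
  have "ennreal (pi * A + 1) = ennreal (e\<^sup>2) * ennreal N"
    using e N0 by (simp add: N_def flip: ennreal_mult)
  also have "\<dots> = (\<integral>\<^sup>+s. ennreal (e\<^sup>2) * indicator {ln r0 - N<..<ln r0} s \<partial>lborel)"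
    using N0 by (subst nn_integral_cmult_indicator) auto
  also have "\<dots> \<le> (\<integral>\<^sup>+s. ennreal pi * F s \<partial>lborel)"
    by (intro nn_integral_mono) (use low in \<open>auto split: split_indicator\<close>)
  also have "\<dots> = ennreal pi * (\<integral>\<^sup>+s. F s \<partial>lborel)"
    unfolding F_def using borel_measurable_nn_integral_vertical by (intro nn_integral_cmult) simp
  also have "(\<integral>\<^sup>+s. F s \<partial>lborel) = (\<integral>\<^sup>+z. ennreal ((cmod (deriv g z))\<^sup>2) * indicator Q z \<partial>lborel)"
    unfolding F_def by (intro nn_integral_complex_iterated[symmetric]) simp
  also have "\<dots> = ennreal A"
    using nn_integral_deriv_eq_area[OF Q hg injg bg] A by simp
  finally have "ennreal (pi * A + 1) \<le> ennreal (pi * A)"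
    using A0 by (simp flip: ennreal_mult)
  then show False using A0 by (subst (asm) ennreal_le_iff) auto
qed

section \<open>Boundary behaviour of the Riemann map\<close>

text \<open>The closure of a connected relatively open neighbourhood remains connected and inside
  the closed set \<open>K\<close>. Starting from radius \<open>e/2\<close> keeps the closure in the
  open ball of radius \<open>e\<close>. Such sets \<open>L\<close> later close up the ends of
  crosscuts.\<close>

lemma locally_connected_compact_connected_nbhd:
  fixes K :: "'a::heine_borel set"
  assumes "closed K" "locally connected K" "p \<in> K" "e > 0"
  obtains d L where "d > 0" "compact L" "connected L" "L \<subseteq> K \<inter> ball p e" "K \<inter> ball p d \<subseteq> L"
proof -
  have "openin (top_of_set K) (K \<inter> ball p (e/2))" by auto
  moreover have "p \<in> K \<inter> ball p (e/2)" using assms by simp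
  ultimately obtain u where u: "openin (top_of_set K) u" "connected u" "p \<in> u" "u \<subseteq> K \<inter> ball p (e/2)"
    using assms(2) unfolding locally_connected by metis
  then obtain N where N: "open N" "u = K \<inter> N" by (auto simp: openin_open)
  then obtain d where d: "d > 0" "ball p d \<subseteq> N" using u(3) open_contains_ball by blast
  have K: "closure u \<subseteq> K" using u(4) assms(1) by (intro closure_minimal) auto
  have b: "closure u \<subseteq> cball p (e/2)" using u(4) by (intro closure_minimal) auto
  show thesis
  proof
    show "compact (closure u)"
      using b by (meson bounded_cball bounded_subset closed_closure compact_eq_bounded_closed)
    show "connected (closure u)" using u(2) by (rule connected_imp_connected_closure)
    show "closure u \<subseteq> K \<inter> ball p e" using K b assms(4) by auto
    show "K \<inter> ball p d \<subseteq> closure u" using d N closure_subset[of u] by auto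
  qed (rule d(1))
qed

section \<open>Continuity of a conformal map up to the circle\<close>

text \<open>\<open>K\<close> may be larger than the frontier of \<open>G\<close>. In the application
  to the exterior domain it is the inverted union of discs, for which local connectedness and
  non-separation are known, while nothing is known yet about the frontier itself.\<close>

locale conformal_disc_map =
  fixes \<phi> \<psi> :: "complex \<Rightarrow> complex" and G K :: "complex set"
  assumes hol: "\<phi> holomorphic_on ball 0 1" and cont_inv: "continuous_on G \<psi>"
    and img: "\<phi> ` ball 0 1 = G" and inv: "\<And>z. z \<in> ball 0 1 \<Longrightarrow> \<psi> (\<phi> z) = z"
    and bounded_G: "bounded G" and closed_K: "closed K"
    and frontier_G: "frontier G \<subseteq> K" and disjoint: "G \<inter> K = {}"
begin

lemma inj: "inj_on \<phi> (ball 0 1)"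
  using inv by (metis inj_on_inverseI)

lemma open_G: "open G"
  using open_mapping_thm3[OF hol open_ball inj] img by simp

lemma connected_G: "connected G"
  using connected_continuous_image[OF holomorphic_on_imp_continuous_on[OF hol] connected_ball] img
  by simp

lemma zero_in_G: "\<phi> 0 \<in> G"
  using img by auto

lemma inv_mem: "w \<in> G \<Longrightarrow> \<psi> w \<in> ball 0 1" "w \<in> G \<Longrightarrow> \<phi> (\<psi> w) = w"
  using img inv by auto

lemma connected_avoiding_K_subset_G:
  assumes "connected C" "C \<inter> K = {}" "C \<inter> G \<noteq> {}"
  shows "C \<subseteq> G"
  using connected_Int_frontier[of C G] assms frontier_G by auto

text \<open>At a limit \<open>q\<close> in \<open>G\<close> the inverse \<psi> would be continuous,
  forcing the points \<open>z n\<close> to converge to \<open>\<psi> q\<close>, a point of the open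
  disc, instead of to \<open>a\<close>.\<close>

lemma limit_notin_G:
  fixes z :: "nat \<Rightarrow> complex"
  assumes z: "\<And>n. z n \<in> ball 0 1" and lim: "z \<longlonglongrightarrow> a" "(\<lambda>n. \<phi> (z n)) \<longlonglongrightarrow> q" and a: "a \<notin> ball 0 1"
  shows "q \<notin> G"
proof
  assume q: "q \<in> G"
  have "(\<lambda>n. \<psi> (\<phi> (z n))) \<longlonglongrightarrow> \<psi> q"
    using continuous_on_tendsto_compose[OF cont_inv lim(2) q] z img by auto
  then have "z \<longlonglongrightarrow> \<psi> q" using inv z by simp
  then have "a = \<psi> q" using lim(1) LIMSEQ_unique by blast
  then show False using inv_mem(1)[OF q] a by simp
qed

text \<open>A small image of a circular arc about \<open>a\<close>, completed by a small connected
  piece \<open>L\<close> of \<open>K\<close>, gives a compact set \<open>A\<close> with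
  \<open>A \<inter> K = L\<close>. If the image of some \<open>x\<close> near \<open>a\<close> were
  far from \<open>p\<close>, then \<open>A\<close> alone and \<open>K\<close> alone would not
  separate it from \<open>\<phi> 0\<close>, hence by Janiszewski neither would their union. The
  preimage of the connecting set would then cross the arc, a contradiction.\<close>

lemma boundary_oscillation:
  assumes lc: "locally connected K" and a: "cmod a = 1" and e: "e > 0"
  shows "\<exists>r>0. \<forall>z \<in> ball 0 1 \<inter> ball a r. \<forall>w \<in> ball 0 1 \<inter> ball a r. dist (\<phi> z) (\<phi> w) < e"
proof -
  have "\<forall>n::nat. \<exists>r>0. r < 1 / Suc n \<and>
     (\<forall>z \<in> ball 0 1 \<inter> sphere a r. \<forall>w \<in> ball 0 1 \<inter> sphere a r. dist (\<phi> z) (\<phi> w) \<le> 1 / Suc n)"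
    using length_area_small_crosscut[OF hol inj _ a] bounded_G img by auto
  then obtain r where r: "\<And>n::nat. r n > 0" "\<And>n. r n < 1 / Suc n"
     "\<And>n z w. z \<in> ball 0 1 \<inter> sphere a (r n) \<Longrightarrow> w \<in> ball 0 1 \<inter> sphere a (r n) \<Longrightarrow> dist (\<phi> z) (\<phi> w) \<le> 1 / Suc n"
    by metis
  have r1: "r n < 1" for n
    using r(2)[of n] by (smt (verit) divide_le_eq_1 of_nat_Suc of_nat_0_le_iff)
  have rlim: "r \<longlonglongrightarrow> 0"
    by (rule real_tendsto_sandwich[OF _ _ tendsto_const LIMSEQ_inverse_real_of_nat])
       (use r in \<open>auto intro!: always_eventually less_imp_le simp: inverse_eq_divide\<close>)
  \<comment> \<open>The point of the radius towards \<open>a\<close> that lies on the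
    \<open>n\<close>-th arc. The images of these points have a cluster point \<open>p\<close>, which
    lies on the frontier by \<open>limit_notin_G\<close>.\<close>
  define z where "z = (\<lambda>n. a * (1 - of_real (r n)))"
  have zn: "cmod (z n) = 1 - r n" for n
  proof -
    have "cmod (z n) = cmod (of_real (1 - r n))" by (simp add: z_def norm_mult a)
    then show ?thesis using r1[of n] by (simp only: norm_of_real)
  qed
  have zd: "dist a (z n) = r n" for n
  proof -
    have "a - z n = a * of_real (r n)" by (simp add: z_def algebra_simps)
    then show ?thesis using r(1)[of n] a by (simp add: dist_norm norm_mult)
  qed
  have zb: "z n \<in> ball 0 1" for n using zn r(1)[of n] by simp
  have zs: "z n \<in> ball 0 1 \<inter> sphere a (r n)" for n using zb zd by simp
  have zlim: "z \<longlonglongrightarrow> a"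
    using rlim zd by (subst tendsto_dist_iff) (simp add: dist_commute)
  have "compact (closure G)" using bounded_G by simp
  moreover have "\<forall>n. \<phi> (z n) \<in> closure G" using zb img closure_subset by blast
  ultimately obtain p s where ps: "p \<in> closure G" "strict_mono s" "((\<lambda>n. \<phi> (z n)) \<circ> s) \<longlonglongrightarrow> p"
    unfolding compact_def by metis
  have "p \<notin> G"
    using limit_notin_G[of "z \<circ> s" a p] zb ps LIMSEQ_subseq_LIMSEQ[OF zlim ps(2)] a by (auto simp: o_def)
  then have "p \<in> frontier G" using ps(1) open_G by (simp add: frontier_def interior_open)
  then have pK: "p \<in> K" using frontier_G by auto
  \<comment> \<open>The bound \<open>e/2\<close> serves the final triangle inequality; the bound
    \<open>dist p (\<phi> 0)\<close> keeps \<open>\<phi> 0\<close> outside the ball that contains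
    \<open>A\<close>.\<close>
  define e' where "e' = min (e/2) (dist p (\<phi> 0))"
  have "p \<noteq> \<phi> 0" using pK disjoint zero_in_G by auto
  then have e': "e' > 0" "e' \<le> e/2" "e' \<le> dist p (\<phi> 0)" using e by (auto simp: e'_def)
  obtain d0 L where L: "d0 > 0" "compact L" "connected L" "L \<subseteq> K \<inter> ball p e'" "K \<inter> ball p d0 \<subseteq> L"
    by (rule locally_connected_compact_connected_nbhd[OF closed_K lc pK e'(1)])
  define d where "d = min d0 e' / 2"
  have d: "d > 0" "d < d0" "d < e'" using L e' by (auto simp: d_def)
  have "\<forall>\<^sub>F n in sequentially. dist (\<phi> (z (s n))) p < d/2"
    using tendstoD[OF ps(3), of "d/2"] d(1) by (simp add: o_def)
  moreover have "\<forall>\<^sub>F n in sequentially. 1 / real (Suc (s n)) < d/2"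
    using tendstoD[OF LIMSEQ_subseq_LIMSEQ[OF LIMSEQ_inverse_real_of_nat ps(2)], of "d/2"] d(1)
    by (simp add: o_def inverse_eq_divide)
  ultimately have "\<exists>n. dist (\<phi> (z (s n))) p < d/2 \<and> 1 / real (Suc (s n)) < d/2"
    by (metis (mono_tags, lifting) eventually_conj eventually_happens' sequentially_bot)
  \<comment> \<open>One image point lies within \<open>d/2\<close> of \<open>p\<close> and the image
    of the arc has diameter below \<open>d/2\<close>, so the whole image stays within
    \<open>d\<close> of \<open>p\<close>.\<close>
  then obtain m where m: "dist (\<phi> (z m)) p < d/2" "1 / real (Suc m) < d/2" by blast
  define c where "c = ball 0 1 \<inter> sphere a (r m)"
  have cd: "\<phi> ` c \<subseteq> cball p d"
  proof
    fix y assume "y \<in> \<phi> ` c"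
    then obtain x where x: "x \<in> c" "y = \<phi> x" by auto
    have "dist (\<phi> x) (\<phi> (z m)) \<le> 1 / Suc m" using r(3)[of x m "z m"] x zs c_def by blast
    then show "y \<in> cball p d" using m x(2) dist_triangle[of p y "\<phi> (z m)"] by (simp add: dist_commute)
  qed
  then have ccd: "closure (\<phi> ` c) \<subseteq> cball p d" by (simp add: closure_minimal)
  define A where "A = closure (\<phi> ` c) \<union> L"
  have cA: "compact A" unfolding A_def
    using L ccd by (metis compact_Un bounded_cball bounded_subset closed_closure compact_eq_bounded_closed)
  have Ab: "A \<subseteq> ball p e'" using ccd d L by (auto simp: A_def)
  \<comment> \<open>The closed crosscut stays within \<open>d < d0\<close> of \<open>p\<close>, and
    \<open>L\<close> contains all of \<open>K\<close> in that range.\<close>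
  have AK: "A \<inter> K = L" using L(4,5) ccd d(2) by (force simp: A_def)
  have main: "\<phi> x \<in> ball p e'" if x: "x \<in> ball 0 1 \<inter> ball a (r m)" for x
  proof (rule ccontr)
    assume nx: "\<phi> x \<notin> ball p e'"
    \<comment> \<open>\<open>\<phi> x\<close> and \<open>\<phi> 0\<close> are joined outside the
      ball, hence off \<open>A\<close>, and inside \<open>G\<close>, hence off
      \<open>K\<close>.\<close>
    have "connected (- ball p e')" by (intro connected_complement_bounded_convex) auto
    moreover have "- ball p e' \<subseteq> - A" "\<phi> 0 \<in> - ball p e'" using Ab e' by auto
    ultimately have 1: "connected_component (- A) (\<phi> x) (\<phi> 0)"
      unfolding connected_component_def using nx by blast
    have 2: "connected_component (- K) (\<phi> x) (\<phi> 0)"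
      unfolding connected_component_def
      by (intro exI[of _ G]) (use connected_G disjoint zero_in_G x img in auto)
    have "connected_component (- (A \<union> K)) (\<phi> x) (\<phi> 0)"
      using Janiszewski[OF cA closed_K _ 1 2] L(3) AK by simp
    then obtain C where C: "connected C" "C \<subseteq> - (A \<union> K)" "\<phi> x \<in> C" "\<phi> 0 \<in> C"
      unfolding connected_component_def by blast
    have CG: "C \<subseteq> G" using connected_avoiding_K_subset_G[of C] C zero_in_G by blast
    have con: "connected (\<psi> ` C)"
      by (rule connected_continuous_image[OF continuous_on_subset[OF cont_inv CG] C(1)])
    have "x \<in> \<psi> ` C" using C(3) inv x by force
    moreover have "0 \<in> \<psi> ` C" using C(4) inv[of 0] by force
    moreover have "0 \<notin> ball a (r m)" using a r1[of m] by simp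
    ultimately have "\<psi> ` C \<inter> frontier (ball a (r m)) \<noteq> {}"
      using x by (intro connected_Int_frontier[OF con]) auto
    then obtain y where y: "y \<in> C" "\<psi> y \<in> sphere a (r m)" using r(1)[of m] by auto
    then have "\<psi> y \<in> c" using CG inv_mem(1) by (auto simp: c_def)
    then have "y \<in> \<phi> ` c" using inv_mem(2)[of y] CG y by force
    then have "y \<in> A" unfolding A_def using subsetD[OF closure_subset, of y "\<phi> ` c"] by simp
    then show False using y C(2) by auto
  qed
  show ?thesis
  proof (intro exI[of _ "r m"] conjI ballI r(1))
    fix x y assume "x \<in> ball 0 1 \<inter> ball a (r m)" "y \<in> ball 0 1 \<inter> ball a (r m)"
    then have "dist p (\<phi> x) < e'" "dist p (\<phi> y) < e'" using main by auto
    then show "dist (\<phi> x) (\<phi> y) < e" using e'(2) dist_triangle3[of "\<phi> x" "\<phi> y" p] by simp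
  qed
qed

text \<open>Every point of the closed disc has a neighbourhood on which \<phi> oscillates by less
  than \<open>e\<close>: by continuity inside and by \<open>boundary_oscillation\<close> on the
  circle. A Lebesgue number of this cover is a uniform modulus.\<close>

lemma uniformly_continuous:
  assumes lc: "locally connected K"
  shows "uniformly_continuous_on (ball 0 1) \<phi>"
proof (unfold uniformly_continuous_on_def, intro allI impI)
  fix e :: real assume e: "e > 0"
  have ex: "\<exists>r>0. \<forall>z \<in> ball 0 1 \<inter> ball a r. \<forall>w \<in> ball 0 1 \<inter> ball a r. dist (\<phi> z) (\<phi> w) < e" if "a \<in> cball 0 1" for a
  proof (cases "a \<in> ball 0 1")
    case True
    then have "isCont \<phi> a"
      by (intro continuous_on_interior[OF holomorphic_on_imp_continuous_on[OF hol]]) simp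
    then obtain r where r: "r > 0" "\<And>z. dist z a < r \<Longrightarrow> dist (\<phi> z) (\<phi> a) < e/2"
      unfolding continuous_at_eps_delta using half_gt_zero[OF e] by blast
    show ?thesis
    proof (intro exI[of _ r] conjI ballI r(1))
      fix z w assume "z \<in> ball 0 1 \<inter> ball a r" "w \<in> ball 0 1 \<inter> ball a r"
      then have "dist z a < r" "dist w a < r" by (simp_all add: dist_commute)
      then show "dist (\<phi> z) (\<phi> w) < e"
        by (metis r(2) dist_triangle_half_l)
    qed
  next
    case False
    then show ?thesis using that boundary_oscillation[OF lc _ e, of a] by auto
  qed
  then obtain r where r: "\<And>a. a \<in> cball 0 1 \<Longrightarrow> r a > 0"
     "\<And>a z w. a \<in> cball 0 1 \<Longrightarrow> z \<in> ball 0 1 \<inter> ball a (r a) \<Longrightarrow> w \<in> ball 0 1 \<inter> ball a (r a) \<Longrightarrow> dist (\<phi> z) (\<phi> w) < e"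
    by metis
  have "cball 0 1 \<subseteq> \<Union>((\<lambda>a. ball a (r a)) ` cball 0 1)"
  proof
    fix x :: complex assume "x \<in> cball 0 1"
    then show "x \<in> \<Union>((\<lambda>a. ball a (r a)) ` cball 0 1)" using r(1) by (intro UN_I[of x]) auto
  qed
  then obtain \<delta> where \<delta>: "\<delta> > 0" "\<And>x. x \<in> cball (0::complex) 1 \<Longrightarrow> \<exists>B \<in> (\<lambda>a. ball a (r a)) ` cball 0 1. ball x \<delta> \<subseteq> B"
    by (rule Heine_Borel_lemma[OF compact_cball]) auto
  show "\<exists>d>0. \<forall>x\<in>ball 0 1. \<forall>x'\<in>ball 0 1. dist x' x < d \<longrightarrow> dist (\<phi> x') (\<phi> x) < e"
  proof (intro exI[of _ \<delta>] conjI ballI impI \<delta>(1))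
    fix x x' assume x: "x \<in> ball (0::complex) 1" "x' \<in> ball (0::complex) 1" "dist x' x < \<delta>"
    then obtain a where a: "a \<in> cball 0 1" "ball x \<delta> \<subseteq> ball a (r a)"
      using \<delta>(2)[of x] ball_subset_cball by blast
    then have "x \<in> ball a (r a)" "x' \<in> ball a (r a)"
      using x(3) \<delta>(1) 
      by (intro subsetD[OF a(2)]; simp add: dist_commute)+
    then show "dist (\<phi> x') (\<phi> x) < e" using r(2)[OF a(1)] x by blast
  qed
qed

end

text \<open>Finitely many rotations of the arc cover the circle, so the product of the rotated copies of
  \<open>h - p\<close> vanishes on the whole circle.\<close>

lemma constant_on_boundary_arc:
  fixes h :: "complex \<Rightarrow> complex"
  assumes ch: "continuous_on (cball 0 1) h" and hh: "h holomorphic_on ball 0 1"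
    and c: "cmod c = 1" and k: "k < 1"
    and hp: "\<And>u. cmod u = 1 \<Longrightarrow> k < Re (u * cnj c) \<Longrightarrow> h u = p"
  shows "h 0 = p"
proof -
  define U where "U = (\<lambda>v. {u. k < Re (v * u * cnj c)})"
  have oU: "open (U v)" for v unfolding U_def
    by (intro open_Collect_less continuous_intros)
  have cov: "sphere 0 1 \<subseteq> \<Union>(U ` sphere 0 1)"
  proof
    fix u :: complex assume u: "u \<in> sphere 0 1"
    \<comment> \<open>The rotation by \<open>c * cnj u\<close> takes \<open>u\<close> to
      \<open>c\<close>, the midpoint of the arc, so the rotated arcs do cover the circle.\<close>
    have "(c * cnj u) * u * cnj c = (c * cnj c) * (u * cnj u)" by (simp add: algebra_simps)
    also have "\<dots> = 1" using u c by (simp only: complex_norm_square[symmetric]) simp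
    finally have "u \<in> U (c * cnj u)" using k unfolding U_def by (metis mem_Collect_eq one_complex.simps(1))
    moreover have "c * cnj u \<in> sphere 0 1" using u c by (simp add: norm_mult)
    ultimately show "u \<in> \<Union>(U ` sphere 0 1)" by blast
  qed
  obtain V where V: "V \<subseteq> sphere (0::complex) 1" "finite V" "sphere 0 1 \<subseteq> \<Union>(U ` V)"
    using compactE_image[OF compact_sphere oU cov] by metis
  define F where "F = (\<lambda>z. \<Prod>v\<in>V. (h (v * z) - p))"
  have rot: "(\<lambda>z. v * z) ` ball 0 1 \<subseteq> ball 0 1" "(\<lambda>z. v * z) ` cball 0 1 \<subseteq> cball 0 1" if "v \<in> V" for v
    using V(1) that by (auto simp: norm_mult)
  have cF: "continuous_on (cball 0 1) F" unfolding F_def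
    by (intro continuous_intros continuous_on_compose2[OF ch] rot) 
  have hF: "F holomorphic_on ball 0 1" unfolding F_def
    by (intro holomorphic_intros holomorphic_on_compose_gen[OF _ hh rot(1), unfolded o_def])
  have "cmod (F 0) \<le> 0"
  proof (rule maximum_modulus_frontier[of F "cball 0 1"])
    fix z :: complex assume "z \<in> frontier (cball 0 1)"
    then have z: "cmod z = 1" by simp
    then obtain v where v: "v \<in> V" "k < Re (v * z * cnj c)" using V(3) by (auto simp: U_def)
    then have "h (v * z) = p" using hp[of "v * z"] z V(1) by (auto simp: norm_mult)
    then have "F z = 0" unfolding F_def using V(2) v(1) by (intro prod_zero) auto
    then show "cmod (F z) \<le> 0" by simp
  qed (use cF hF in auto)
  then show ?thesis using V(2) by (auto simp: F_def)
qed

section \<open>Injectivity on the circle and the homeomorphic extension\<close>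

context conformal_disc_map begin

text \<open>Two radii with a common end image \<open>p\<close> bound a region \<open>Y\<close> of
  \<open>G\<close> free of \<open>K\<close>. A sector of the disc around a point of the preimage of
  \<open>Y\<close> maps into \<open>Y\<close>, so its circular edge maps into
  \<open>closure Y \<inter> K\<close>, which is at most \<open>{p}\<close>; this contradicts
  \<open>constant_on_boundary_arc\<close>.\<close>

lemma boundary_injective:
  assumes Kp: "\<And>p. p \<in> K \<Longrightarrow> connected (K - {p})"
    and ch: "continuous_on (cball 0 1) h" and h\<phi>: "\<And>z. z \<in> ball 0 1 \<Longrightarrow> h z = \<phi> z"
    and hK: "\<And>u. u \<in> sphere 0 1 \<Longrightarrow> h u \<in> K"
    and ab: "a \<in> sphere 0 1" "b \<in> sphere 0 1" "a \<noteq> b"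
  shows "h a \<noteq> h b"
proof
  assume hab: "h a = h b"
  define p where "p = h a"
  have pK: "p \<in> K" using hK ab p_def by auto
  define q where "q = linepath a 0 +++ linepath 0 b"
  have inter: "closed_segment a 0 \<inter> closed_segment 0 b \<subseteq> {0}"
  proof
    fix x assume "x \<in> closed_segment a 0 \<inter> closed_segment 0 b"
    then obtain s t where st: "x = (1-s) *\<^sub>R a" "x = t *\<^sub>R b" "0 \<le> t" "s \<le> 1"
      unfolding in_segment by (metis Int_iff add.right_neutral add_0 in_segment(1) scaleR_zero_right)
    then have "norm x = 1 - s" "norm x = t"
      using ab by (metis (no_types) abs_of_nonneg diff_ge_0_iff_ge mem_sphere_0 mult.right_neutral norm_scaleR)+
    then have "x = t *\<^sub>R a" using st(1) by simp
    then have "t *\<^sub>R a = t *\<^sub>R b" using st(2) by (rule trans[OF sym])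
    then show "x \<in> {0}" using st(2) ab(3) by (metis scaleR_cancel_left scaleR_zero_left singletonI)
  qed
  have aq: "arc q" unfolding q_def
  proof (intro arc_join arc_linepath)
    show "a \<noteq> 0" "0 \<noteq> b" using ab by auto
  qed (use inter in auto)
  have pq: "path_image q = closed_segment a 0 \<union> closed_segment 0 b"
    by (simp add: q_def path_image_join)
  have pqE: "\<exists>s y. x = s *\<^sub>R y \<and> 0 \<le> s \<and> s \<le> 1 \<and> y \<in> {a,b}" if "x \<in> path_image q" for x
    using that unfolding pq
  proof
    assume "x \<in> closed_segment a 0"
    then obtain u where "x = (1 - u) *\<^sub>R a" "0 \<le> u" "u \<le> 1" by (auto simp: in_segment)
    then show ?thesis by (intro exI[of _ "1 - u"] exI[of _ a]) simp
  next
    assume "x \<in> closed_segment 0 b"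
    then obtain u where "x = u *\<^sub>R b" "0 \<le> u" "u \<le> 1" by (auto simp: in_segment)
    then show ?thesis by blast
  qed
  have qb: "path_image q \<subseteq> cball 0 1" unfolding pq using ab
    by (intro Un_least closed_segment_subset) auto
  have qint: "path_image q - {a,b} \<subseteq> ball 0 1"
  proof
    fix x assume x: "x \<in> path_image q - {a,b}"
    obtain s y where y: "x = s *\<^sub>R y" "0 \<le> s" "s \<le> 1" "y \<in> {a,b}"
      using x pqE by blast
    then have "s \<noteq> 1" using x by auto
    moreover have "cmod y = 1" using y(4) ab by auto
    ultimately show "x \<in> ball 0 1" using y(1-3) by simp
  qed
  have q01: "q 0 = a" "q 1 = b" by (simp_all add: q_def joinpaths_def linepath_def)
  have qinj: "inj_on q {0..1}" using aq by (simp add: arc_def)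
  have qab: "q t = a \<longleftrightarrow> t = 0" "q t = b \<longleftrightarrow> t = 1" if "t \<in> {0..1}" for t
    using inj_on_eq_iff[OF qinj that, of 0] inj_on_eq_iff[OF qinj that, of 1] unfolding q01 by simp_all
  \<comment> \<open>Inner points of \<open>q\<close> map injectively into \<open>G\<close>, while
    both ends map to \<open>p\<close>, which is not in \<open>G\<close>. Hence \<open>c\<close> is a
    loop with no other self-intersection.\<close>
  define c where "c = h \<circ> q"
  have \<psi>h: "\<psi> (h x) = x" if "x \<in> ball 0 1" for x
    unfolding h\<phi>[OF that] by (rule inv[OF that])
  have Ginj: "x = y" if "x \<in> ball 0 1" "y \<in> ball 0 1" "h x = h y" for x y
    using arg_cong[OF that(3), of \<psi>] unfolding \<psi>h[OF that(1)] \<psi>h[OF that(2)] .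
  have hG: "h x \<in> G" if "x \<in> ball 0 1" for x
    unfolding h\<phi>[OF that] img[symmetric] using that by (rule imageI)
  have pG: "p \<notin> G" using pK disjoint by auto
  have "path c" unfolding c_def
    by (intro path_continuous_image arc_imp_path aq continuous_on_subset[OF ch qb])
  moreover have "loop_free c"
    unfolding loop_free_def
  proof (intro ballI impI)
    fix x y :: real assume xy: "x \<in> {0..1}" "y \<in> {0..1}" "c x = c y"
    have m: "q x \<in> ball 0 1 \<or> q x \<in> {a,b}" "q y \<in> ball 0 1 \<or> q y \<in> {a,b}"
      using qint imageI[OF xy(1), of q] imageI[OF xy(2), of q] unfolding path_image_def by blast+
    consider "q x \<in> ball 0 1" "q y \<in> ball 0 1" | "q x \<in> {a,b}" "q y \<in> {a,b}"
    proof -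
      have hp: "h w = p" if "w \<in> {a,b}" for w using that hab p_def by auto
      have "h (q x) = h (q y)" using xy(3) by (simp add: c_def)
      then have "q x \<in> ball 0 1 \<longleftrightarrow> q y \<in> ball 0 1"
        using m hG[of "q x"] hG[of "q y"] hp[of "q x"] hp[of "q y"] pG by auto
      then show thesis using m that by blast
    qed
    then show "x = y \<or> x = 0 \<and> y = 1 \<or> x = 1 \<and> y = 0"
    proof cases
      case 1
      then have "q x = q y" using Ginj xy(3) unfolding c_def o_def by blast
      then show ?thesis using inj_onD[OF qinj] xy by blast
    next
      case 2
      then show ?thesis using qab[OF xy(1)] qab[OF xy(2)] by blast
    qed
  qed
  ultimately have sc: "simple_path c" by (simp add: simple_path_def)
  have lc: "pathfinish c = pathstart c"
    by (simp add: pathfinish_def pathstart_def c_def q01 hab)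
  define J where "J = path_image c"
  have Jq: "J = h ` path_image q" by (simp add: J_def c_def path_image_compose)
  have pJ: "p \<in> J" unfolding Jq pq p_def by auto
  have JK: "J \<inter> K \<subseteq> {p}"
  proof
    fix y assume "y \<in> J \<inter> K"
    then obtain x where x: "x \<in> path_image q" "y = h x" "y \<in> K" using Jq by auto
    then have "x \<notin> ball 0 1" using hG disjoint by auto
    then show "y \<in> {p}" using qint x hab p_def by auto
  qed
  obtain X Z where XZ: "X \<noteq> {}" "open X" "connected X" "Z \<noteq> {}" "open Z" "connected Z"
      "X \<inter> Z = {}" "X \<union> Z = - J" "frontier X = J" "frontier Z = J"
    using Jordan_curve[OF sc lc] unfolding J_def by metis
  have "K - {p} \<subseteq> X \<union> Z" using JK XZ(8) by auto
  \<comment> \<open>The connected set \<open>K - {p}\<close> avoids \<open>J\<close>, so it lies on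
    one side; the other side is the region \<open>Y\<close>.\<close>
  then have "X \<inter> (K - {p}) = {} \<or> Z \<inter> (K - {p}) = {}"
    using connectedD[OF Kp[OF pK] XZ(2,5)] XZ(7) by auto
  then obtain Y where Y: "Y \<noteq> {}" "open Y" "connected Y" "frontier Y = J" "Y \<inter> (K - {p}) = {}"
     "\<And>C. connected C \<Longrightarrow> C \<inter> J = {} \<Longrightarrow> C \<inter> Y \<noteq> {} \<Longrightarrow> C \<subseteq> Y"
  proof -
    have "C \<subseteq> Y" if "connected C" "C \<inter> frontier Y = {}" "C \<inter> Y \<noteq> {}" for C Y :: "complex set"
      using connected_Int_frontier[of C Y] that by auto
    then show thesis using that[of X] that[of Z] XZ \<open>X \<inter> (K - {p}) = {} \<or> Z \<inter> (K - {p}) = {}\<close> by metis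
  qed
  have YJ: "Y \<inter> J = {}" using Y(2,4) by (auto simp: frontier_def interior_open)
  then have YK: "Y \<inter> K = {}" using Y(5) pJ by auto
  \<comment> \<open>The two radii meet at 0, so \<open>\<phi> 0\<close> lies in \<open>G\<close> and
    on the frontier of \<open>Y\<close>. Therefore \<open>Y\<close> meets the open set
    \<open>G\<close>, and avoiding \<open>K\<close> it lies in \<open>G\<close>.\<close>
  have "\<phi> 0 \<in> J" unfolding Jq pq using h\<phi>[of 0] by (metis UnCI centre_in_ball ends_in_segment(2) imageI zero_less_one)
  then have "\<phi> 0 \<in> closure Y" using Y(4) by (auto simp: frontier_def)
  then have YGne: "Y \<inter> G \<noteq> {}"
    using open_Int_closure_eq_empty[OF open_G, of Y] zero_in_G by blast
  have YG: "Y \<subseteq> G" by (rule connected_avoiding_K_subset_G[OF Y(3) YK YGne])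
  obtain y where y: "y \<in> Y" using Y(1) by auto
  define z where "z = \<psi> y"
  have z1: "z \<in> ball 0 1" unfolding z_def by (rule inv_mem(1)[OF subsetD[OF YG y]])
  have z2: "h z = y" unfolding h\<phi>[OF z1] unfolding z_def by (rule inv_mem(2)[OF subsetD[OF YG y]])
  note z = z1 z2
  have zq: "z \<notin> path_image q" using z(2) y YJ Jq by auto
  moreover have "0 \<in> path_image q" unfolding pq by simp
  ultimately have z0: "z \<noteq> 0" by metis
  \<comment> \<open>Direction of the preimage \<open>z\<close> of a point of \<open>Y\<close>. It
    differs from \<open>a\<close> and \<open>b\<close> because \<open>z\<close> lies on neither
    radius.\<close>
  define c0 where "c0 = z / of_real (cmod z)"
  have c0: "cmod c0 = 1" using z0 by (simp add: c0_def norm_divide)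
  have zc0: "z = cmod z *\<^sub>R c0" using z0 by (simp add: c0_def scaleR_conv_of_real)
  have ne: "c0 \<noteq> a" "c0 \<noteq> b"
  proof -
    have "z \<in> closed_segment c0 0" "z \<in> closed_segment 0 c0"
      unfolding in_segment using z(1)
      by (intro exI[of _ "1 - cmod z"] exI[of _ "cmod z"] conjI; simp add: zc0[symmetric])+
    then show "c0 \<noteq> a" "c0 \<noteq> b" using zq unfolding pq by blast+
  qed
  have Re1: "Re (u * cnj c0) < 1" if "cmod u = 1" "c0 \<noteq> u" for u
  proof -
    have "(cmod (u - c0))\<^sup>2 = (cmod u)\<^sup>2 + (cmod c0)\<^sup>2 - 2 * Re (u * cnj c0)"
      by (simp add: cmod_power2) (simp add: power2_eq_square algebra_simps)
    moreover have "(cmod (u - c0))\<^sup>2 > 0" using that by simp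
    ultimately show ?thesis using that c0 by simp
  qed
  \<comment> \<open>As the larger of the two cosines, \<open>k\<close> makes the sector
    \<open>S\<close> around \<open>c0\<close> exclude both radii. Raising it to at least 0 makes
    \<open>k * cmod w\<close> a convex function, so the sector is convex.\<close>
  define k where "k = max 0 (max (Re (a * cnj c0)) (Re (b * cnj c0)))"
  have k: "k < 1" "0 \<le> k" "Re (a * cnj c0) \<le> k" "Re (b * cnj c0) \<le> k"
    using Re1 ne ab by (auto simp: k_def)
  define S where "S = ball 0 1 \<inter> {w. k * cmod w - Re (w * cnj c0) < 0}"
  have Re_cone: "convex {w. k * cmod w - Re (w * cnj c0) < 0}"
  proof (rule convexI)
    fix x y :: complex and u v :: real
    assume xy: "x \<in> {w. k * cmod w - Re (w * cnj c0) < 0}" "y \<in> {w. k * cmod w - Re (w * cnj c0) < 0}"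
      and uv: "0 \<le> u" "0 \<le> v" "u + v = 1"
    have "k * cmod (u *\<^sub>R x + v *\<^sub>R y) \<le> k * (u * cmod x + v * cmod y)"
      using norm_triangle_ineq[of "u *\<^sub>R x" "v *\<^sub>R y"] uv k(2) by (intro mult_left_mono) auto
    also have "\<dots> = u * (k * cmod x) + v * (k * cmod y)" by (simp add: algebra_simps)
    also have "\<dots> < u * Re (x * cnj c0) + v * Re (y * cnj c0)"
      using xy uv by (cases "u = 0") (auto intro!: add_less_le_mono mult_left_mono)
    also have "\<dots> = Re ((u *\<^sub>R x + v *\<^sub>R y) * cnj c0)" by (simp add: algebra_simps)
    finally show "u *\<^sub>R x + v *\<^sub>R y \<in> {w. k * cmod w - Re (w * cnj c0) < 0}" by simp
  qed
  have cS: "connected S" unfolding S_def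
    by (intro convex_connected convex_Int Re_cone) auto
  have cone_iff: "u \<in> S" if "u = s *\<^sub>R v" "0 < s" "s < 1" "cmod v = 1" "k < Re (v * cnj c0)" for u v s
  proof -
    have "s * k < s * Re (v * cnj c0)" using that by simp
    then show ?thesis using that by (simp add: S_def mult.commute algebra_simps)
  qed
  have "Re (c0 * cnj c0) = 1" using c0 by (simp only: complex_norm_square[symmetric]) simp
  then have zS: "z \<in> S" using cone_iff[OF zc0] z0 z(1) c0 k by simp
  have Sq: "S \<inter> path_image q = {}"
  proof -
    have "s *\<^sub>R u \<notin> S" if "u \<in> {a,b}" "0 \<le> s" for s u
    proof -
      have "cmod u = 1" "Re (u * cnj c0) \<le> k" using that ab k by auto
      then have "s * Re (u * cnj c0) \<le> s * k" using that by (intro mult_left_mono) auto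
      then show ?thesis using \<open>cmod u = 1\<close> that(2) by (simp add: S_def mult.commute algebra_simps)
    qed
    then show ?thesis using pqE by blast
  qed
  have hS: "h ` S \<subseteq> Y"
  proof (rule Y(6))
    show "connected (h ` S)"
      by (intro connected_continuous_image cS continuous_on_subset[OF ch]) (auto simp: S_def)
    show "h ` S \<inter> Y \<noteq> {}" using zS z(2) y by auto
    show "h ` S \<inter> J = {}"
    proof (rule ccontr)
      assume "h ` S \<inter> J \<noteq> {}"
      then obtain x w where xw: "x \<in> S" "w \<in> path_image q" "h x = h w" unfolding Jq by auto
      then have x: "x \<in> ball 0 1" "x \<noteq> w" using Sq by (auto simp: S_def)
      show False
      proof (cases "w \<in> ball 0 1")
        case True then show False using Ginj x xw by blast
      next
        case False
        then have "h w = p" using qint xw hab p_def by auto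
        then show False using hG[OF x(1)] xw pG by auto
      qed
    qed
  qed
  have "h 0 = p"
  proof (rule constant_on_boundary_arc[OF ch _ c0 k(1)])
    show "h holomorphic_on ball 0 1" using hol h\<phi> by (metis holomorphic_cong)
    fix u assume u: "cmod u = 1" "k < Re (u * cnj c0)"
    \<comment> \<open>Radial approach to \<open>u\<close> from within \<open>S\<close>. The factor
      is \<open>1 - 1/(n + 2)\<close>, positive already for \<open>n = 0\<close>, as
      \<open>cone_iff\<close> requires.\<close>
    define s where "s = (\<lambda>n. (1 - inverse (real (Suc n) + 1)) *\<^sub>R u)"
    have "s n \<in> S" for n
      by (rule cone_iff[OF _ _ _ u]) (auto simp: s_def inverse_less_1_iff)
    then have sY: "h (s n) \<in> Y" for n using hS by auto
    have "(\<lambda>n. 1 - inverse (real (Suc n) + 1)) \<longlonglongrightarrow> 1 - 0"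
      by (intro tendsto_diff tendsto_const) real_asymp
    then have "s \<longlonglongrightarrow> (1 - 0) *\<^sub>R u" unfolding s_def by (intro tendsto_scaleR tendsto_const)
    then have "s \<longlonglongrightarrow> u" by simp
    moreover have "\<forall>n. s n \<in> cball 0 1" using \<open>\<And>n. s n \<in> S\<close> by (auto simp: S_def intro: less_imp_le)
    ultimately have "(\<lambda>n. h (s n)) \<longlonglongrightarrow> h u"
      using u by (intro continuous_on_tendsto_compose[OF ch]) auto
    then have "h u \<in> closure Y"
      unfolding closure_sequential using sY by (intro exI[of _ "\<lambda>n. h (s n)"]) simp
    then have "h u \<in> Y \<union> J" unfolding closure_Un_frontier Y(4) .
    moreover have "h u \<in> K" using hK u by simp
    ultimately show "h u = p" using YK JK by blast
  qed
  moreover have "h 0 \<in> G" by (rule hG) simp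
  ultimately show False using pG by metis
qed

text \<open>Uniform continuity extends \<phi> to the closed disc. By \<open>limit_notin_G\<close>
  the circle maps outside \<open>G\<close>, so an inner and a boundary point never share an image,
  and injectivity splits into the conformal case and \<open>boundary_injective\<close>.\<close>

lemma boundary_extension:
  assumes lc: "locally connected K" and Kp: "\<And>p. p \<in> K \<Longrightarrow> connected (K - {p})"
  obtains h :: "complex \<Rightarrow> complex" where "continuous_on (cball 0 1) h" "inj_on h (cball 0 1)" "h ` cball 0 1 = closure G"
    "h ` sphere 0 1 = frontier G" "h ` ball 0 1 = G"
proof -
  obtain h where h: "uniformly_continuous_on (closure (ball 0 1)) h" "\<And>x. x \<in> ball 0 1 \<Longrightarrow> \<phi> x = h x"
    using uniformly_continuous_on_extension_on_closure[OF uniformly_continuous[OF lc]] by metis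
  have ch: "continuous_on (cball 0 1) h"
    using uniformly_continuous_imp_continuous[OF h(1)] by simp
  have hb: "h ` ball 0 1 = G" using h(2) img by (metis image_cong)
  have "h ` cball 0 1 \<subseteq> closure G"
    using image_closure_subset[of "ball 0 1" h "closure G"] ch hb closure_subset[of G] by simp
  moreover have "closure G \<subseteq> h ` cball 0 1"
  proof (rule closure_minimal)
    show "G \<subseteq> h ` cball 0 1" unfolding hb[symmetric] by (intro image_mono) auto
    show "closed (h ` cball 0 1)"
      by (intro compact_imp_closed compact_continuous_image ch) auto
  qed
  ultimately have hc: "h ` cball 0 1 = closure G" by blast
  have hs: "h u \<in> frontier G" if u: "u \<in> sphere 0 1" for u
  proof -
    have "u \<in> closure (ball 0 1)" using u by simp
    then obtain z where z: "\<And>n. z n \<in> ball 0 1" "z \<longlonglongrightarrow> u" unfolding closure_sequential by blast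
    have "(\<lambda>n. h (z n)) \<longlonglongrightarrow> h u"
      by (rule continuous_on_tendsto_compose[OF ch z(2)]) (use u z(1) in \<open>auto intro!: always_eventually less_imp_le\<close>)
    then have "(\<lambda>n. \<phi> (z n)) \<longlonglongrightarrow> h u" using h(2) z(1) by simp
    then have "h u \<notin> G" using limit_notin_G[OF z] u by simp
    moreover have "h u \<in> closure G" using hc u by force
    ultimately show ?thesis using open_G by (simp add: frontier_def interior_open)
  qed
  have disj: "frontier G \<inter> G = {}" using disjoint frontier_G by auto
  have sph: "h ` sphere 0 1 = frontier G"
  proof
    show "h ` sphere 0 1 \<subseteq> frontier G" using hs by auto
    show "frontier G \<subseteq> h ` sphere 0 1"
    proof
      fix y assume y: "y \<in> frontier G"
      then have "y \<in> h ` cball 0 1" unfolding hc by (simp add: frontier_def)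
      then obtain x where x: "x \<in> cball 0 1" "y = h x" by auto
      moreover have "x \<notin> ball 0 1" using x(2) y hb disj by auto
      ultimately show "y \<in> h ` sphere 0 1" by auto
    qed
  qed
  have "inj_on h (cball 0 1)"
  proof (rule inj_onI)
    fix x y assume xy: "x \<in> cball (0::complex) 1" "y \<in> cball (0::complex) 1" "h x = h y"
    have m: "x \<in> ball 0 1 \<or> x \<in> sphere 0 1" "y \<in> ball 0 1 \<or> y \<in> sphere 0 1" using xy by auto
    have G: "h w \<in> G" if "w \<in> ball 0 1" for w using that hb by auto
    consider "x \<in> ball 0 1" "y \<in> ball 0 1" | "x \<in> sphere 0 1" "y \<in> sphere 0 1"
      using m G hs disj xy(3) by (metis IntI empty_iff)
    then show "x = y"
    proof cases
      case 1 then show ?thesis using xy(3) h(2) inv by metis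
    next
      case 2 then show ?thesis using boundary_injective[OF Kp ch _ _ 2] hs frontier_G h(2) xy(3)
        by (metis subsetD)
    qed
  qed
  then show thesis by (rule that[OF ch _ hc sph hb])
qed

end

text \<open>The Riemann map of \<open>G\<close> and its inverse meet the requirements of the locale
  \<open>conformal_disc_map\<close>.\<close>

theorem Caratheodory_extension:
  fixes G K :: "complex set"
  assumes G: "open G" "bounded G" "simply_connected G" "G \<noteq> {}"
    and K: "closed K" "frontier G \<subseteq> K" "G \<inter> K = {}"
    and lc: "locally connected K" and Kp: "\<And>p. p \<in> K \<Longrightarrow> connected (K - {p})"
  obtains h :: "complex \<Rightarrow> complex" where "continuous_on (cball 0 1) h" "inj_on h (cball 0 1)" "h ` cball 0 1 = closure G"
    "h ` sphere 0 1 = frontier G" "h ` ball 0 1 = G"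
proof -
  have "G \<noteq> UNIV" using G(2) not_bounded_UNIV by metis
  then obtain f g where fg: "f holomorphic_on G" "g holomorphic_on ball 0 1"
      "\<And>z. z \<in> G \<Longrightarrow> f z \<in> ball 0 1 \<and> g (f z) = z" "\<And>z. z \<in> ball 0 1 \<Longrightarrow> g z \<in> G \<and> f (g z) = z"
    using Riemann_mapping_theorem[of G] G by metis
  interpret conformal_disc_map g f G K
  proof
    show "g ` ball 0 1 = G" 
    proof
      show "g ` ball 0 1 \<subseteq> G" using fg(4) by blast
      show "G \<subseteq> g ` ball 0 1"
      proof
        fix z assume "z \<in> G"
        then show "z \<in> g ` ball 0 1" using fg(3)[of z] by (intro image_eqI[of _ _ "f z"]) simp_all
      qed
    qed
  qed (use fg(1,2,4) G K holomorphic_on_imp_continuous_on[OF fg(1)] in simp_all)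
  show thesis using boundary_extension[OF lc] Kp that by blast
qed

section \<open>Locally connected unions and inversion\<close>

lemma homeomorphic_locally_connected:
  fixes S :: "'a::metric_space set" and T :: "'b::metric_space set"
  assumes "S homeomorphic T"
  shows "locally connected S \<longleftrightarrow> locally connected T"
  using homeomorphic_locally[OF assms, of connected connected] homeomorphic_connectedness by blast

text \<open>Here the curve \<open>J\<close> itself serves as \<open>K\<close>: it is homeomorphic to
  a circle, which is locally connected and stays connected without any one point, since
  stereographic projection turns a punctured circle into a line.\<close>

lemma closure_inside_simple_loop_homeomorphic_disc:
  fixes c :: "real \<Rightarrow> complex"
  assumes c: "simple_path c" "pathfinish c = pathstart c"
  shows "closure (inside (path_image c)) homeomorphic cball (0::complex) 1"
proof -
  define J where "J = path_image c"
  have hom: "J homeomorphic sphere (0::complex) 1"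
    unfolding J_def by (rule homeomorphic_simple_path_image_circle[OF c]) simp
  obtain f g where fg: "homeomorphism J (sphere (0::complex) 1) f g"
    using hom unfolding homeomorphic_def by blast
  note J = Jordan_inside_outside[OF c, folded J_def]
  have "locally connected J"
    using homeomorphic_locally_connected[OF hom] locally_connected_sphere by blast
  moreover have "connected (J - {p})" if p: "p \<in> J" for p
  proof -
    have "inj_on f J" using fg by (metis homeomorphism_def inj_on_inverseI)
    then have "f ` (J - {p}) = f ` J - f ` {p}"
      using p by (intro inj_on_image_set_diff) auto
    also have "f ` J = sphere 0 1" using fg by (simp add: homeomorphism_def)
    finally have "homeomorphism (J - {p}) (sphere 0 1 - {f p}) f g"
      by (intro homeomorphism_of_subsets[OF fg]) auto
    moreover have "sphere 0 1 - {f p} homeomorphic {x::complex. 1 \<bullet> x = 0}"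
      using fg p by (intro homeomorphic_punctured_sphere_hyperplane) (auto simp: homeomorphism_def)
    moreover have "connected {x::complex. 1 \<bullet> x = 0}"
      by (intro convex_connected convex_hyperplane)
    ultimately show ?thesis
      by (meson homeomorphic_connectedness homeomorphic_def)
  qed
  moreover have "closed J" "J \<inter> inside J = {}"
    using closed_simple_path_image[OF c(1)] inside_no_overlap[of J] by (simp_all add: J_def Int_commute)
  moreover have "simply_connected (inside J)"
    unfolding J_def by (rule simply_connected_inside_simple_path[OF c(1)])
  ultimately obtain h :: "complex \<Rightarrow> complex" where
      "continuous_on (cball 0 1) h" "inj_on h (cball 0 1)" "h ` cball 0 1 = closure (inside J)"
    using Caratheodory_extension[of "inside J" J] J by (metis Int_commute order_refl)
  then have "cball (0::complex) 1 homeomorphic closure (inside J)"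
    by (intro homeomorphic_compact[of _ h]) auto
  then show ?thesis unfolding J_def by (rule homeomorphic_sym[THEN iffD1])
qed

section \<open>Topology of finite unions of discs\<close>

text \<open>It suffices that points near \<open>x\<close> can be joined to \<open>x\<close> by small
  connected sets. A nearby point lies in \<open>S\<close> or in \<open>T\<close>, and it is joined
  to \<open>x\<close> within that one set; closedness ensures that a set not containing
  \<open>x\<close> has no points near \<open>x\<close>.\<close>

lemma locally_connected_closed_Un:
  fixes S T :: "'a::metric_space set"
  assumes "closed S" "closed T" "locally connected S" "locally connected T"
  shows "locally connected (S \<union> T)"
proof -
  have *: "\<exists>d>0. \<forall>y \<in> A \<inter> ball x d. \<exists>c. connected c \<and> c \<subseteq> A \<inter> v \<and> x \<in> c \<and> y \<in> c"
    if lc: "locally connected A" and x: "x \<in> A" "x \<in> v" and v: "open v" for A v :: "'a set" and x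
  proof -
    have "openin (top_of_set A) (A \<inter> v)" "x \<in> A \<inter> v" using v x by auto
    then obtain u where u: "openin (top_of_set A) u" "connected u" "x \<in> u" "u \<subseteq> A \<inter> v"
      using lc unfolding locally_connected by metis
    then obtain N where N: "open N" "u = A \<inter> N" by (auto simp: openin_open)
    then obtain d where d: "d > 0" "ball x d \<subseteq> N" using u(3) open_contains_ball by blast
    then show ?thesis using u N by blast
  qed
  have **: "\<exists>d>0. \<forall>y \<in> A \<inter> ball x d. \<exists>c. connected c \<and> c \<subseteq> A \<inter> v \<and> x \<in> c \<and> y \<in> c"
    if "closed A" "locally connected A" "open v" "x \<in> v" for A v :: "'a set" and x
  proof (cases "x \<in> A")
    case True then show ?thesis using * that by blast
  next
    case False
    then obtain d where "d > 0" "ball x d \<subseteq> - A"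
      using \<open>closed A\<close> by (metis ComplI open_Compl open_contains_ball)
    then show ?thesis by blast
  qed
  show ?thesis unfolding locally_connected_im_kleinen
  proof (intro allI impI, elim conjE)
    fix v x assume v: "openin (top_of_set (S \<union> T)) v" "x \<in> v"
    then obtain N where N: "open N" "v = (S \<union> T) \<inter> N" by (auto simp: openin_open)
    then have xO: "x \<in> N" using v by auto
    obtain d1 where d1: "d1 > 0" "\<forall>y \<in> S \<inter> ball x d1. \<exists>c. connected c \<and> c \<subseteq> S \<inter> N \<and> x \<in> c \<and> y \<in> c"
      using **[OF assms(1,3) N(1) xO] by blast
    obtain d2 where d2: "d2 > 0" "\<forall>y \<in> T \<inter> ball x d2. \<exists>c. connected c \<and> c \<subseteq> T \<inter> N \<and> x \<in> c \<and> y \<in> c"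
      using **[OF assms(2,4) N(1) xO] by blast
    define u where "u = (S \<union> T) \<inter> (N \<inter> (ball x d1 \<inter> ball x d2))"
    show "\<exists>u. openin (top_of_set (S \<union> T)) u \<and> x \<in> u \<and> u \<subseteq> v \<and>
             (\<forall>y. y \<in> u \<longrightarrow> (\<exists>c. connected c \<and> c \<subseteq> v \<and> x \<in> c \<and> y \<in> c))"
    proof (rule exI[of _ u], intro conjI allI impI)
      show "openin (top_of_set (S \<union> T)) u" unfolding u_def using N(1) by (intro openin_open_Int) auto
      show "x \<in> u" using v(2) N xO d1(1) d2(1) by (auto simp: u_def)
      show "u \<subseteq> v" by (auto simp: u_def N)
      fix y assume "y \<in> u"
      then have "y \<in> S \<inter> ball x d1 \<or> y \<in> T \<inter> ball x d2" by (auto simp: u_def)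
      then show "\<exists>c. connected c \<and> c \<subseteq> v \<and> x \<in> c \<and> y \<in> c"
      proof
        assume "y \<in> S \<inter> ball x d1"
        with d1(2) obtain c where "connected c" "c \<subseteq> S \<inter> N" "x \<in> c" "y \<in> c" by blast
        then show ?thesis using N(2) by blast
      next
        assume "y \<in> T \<inter> ball x d2"
        with d2(2) obtain c where "connected c" "c \<subseteq> T \<inter> N" "x \<in> c" "y \<in> c" by blast
        then show ?thesis using N(2) by blast
      qed
    qed
  qed
qed

lemma locally_connected_finite_closed_UN:
  fixes V :: "'i \<Rightarrow> 'a::metric_space set"
  assumes "finite I" "\<And>i. i \<in> I \<Longrightarrow> closed (V i)" "\<And>i. i \<in> I \<Longrightarrow> locally connected (V i)"
  shows "locally connected (\<Union>i\<in>I. V i)"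
  using assms
proof (induction I rule: finite_induct)
  case empty then show ?case by (simp add: locally_def)
next
  case (insert i I)
  have "closed (\<Union>i\<in>I. V i)" using insert by (intro closed_UN) auto
  then show ?case using insert by (simp add: locally_connected_closed_Un)
qed

text \<open>By invariance of domain the image of the open ball is open, hence interior to
  \<open>V\<close>, and its closure contains the image of the closed ball.\<close>

lemma homeomorphic_disc_subset_closure_interior:
  fixes V :: "'a::euclidean_space set"
  assumes "V homeomorphic cball (0::'a) 1"
  shows "V \<subseteq> closure (interior V)"
proof -
  obtain f g where fg: "homeomorphism (cball (0::'a) 1) V f g"
    using assms homeomorphic_sym unfolding homeomorphic_def by metis
  have cf: "continuous_on (cball 0 1) f" and img: "f ` cball 0 1 = V"
    using fg by (auto simp: homeomorphism_def)
  have "inj_on f (cball 0 1)" using fg by (metis homeomorphism_def inj_on_inverseI)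
  then have "open (f ` ball 0 1)"
    using cf by (intro invariance_of_domain) (auto intro: continuous_on_subset inj_on_subset)
  moreover have "f ` ball 0 1 \<subseteq> V" using img by auto
  ultimately have "f ` ball 0 1 \<subseteq> interior V" by (simp add: interior_maximal)
  then have "f ` ball 0 1 \<subseteq> closure (interior V)" using closure_subset by blast
  then have "f ` closure (ball 0 1) \<subseteq> closure (interior V)"
    using cf by (intro image_closure_subset) auto
  then show ?thesis using img by simp
qed

text \<open>In dimension at least 2, \<open>U - F\<close> is still connected, and it is dense in
  \<open>U\<close>; \<open>K - F\<close> lies between it and its closure.\<close>

lemma connected_diff_finite_dense:
  fixes U K F :: "'a::euclidean_space set"
  assumes "open U" "connected U" "2 \<le> DIM('a)" "finite F" "U \<subseteq> K" "K \<subseteq> closure U"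
  shows "connected (K - F)"
proof (rule connected_intermediate_closure[of "U - F"])
  show "connected (U - F)" using assms by (intro connected_open_delete_finite) auto
  have "closure (- F) = UNIV"
    using assms(4) by (simp add: closure_complement empty_interior_finite)
  then have "U \<subseteq> closure (U - F)"
    using open_Int_closure_subset[OF assms(1), of "- F"] by (simp add: Diff_eq)
  then have "closure U \<subseteq> closure (U - F)" by (simp add: closure_minimal)
  then show "K - F \<subseteq> closure (U - F)" using assms(6) by auto
qed (use assms in auto)

section \<open>Neighbourhoods of infinity and inversion\<close>

lemma subset_unbounded_component:
  fixes W K :: "'a::euclidean_space set"
  assumes "2 \<le> DIM('a)" "K \<subseteq> cball c R" "W \<in> components (- K)" "\<not> bounded W"
  shows "- cball c R \<subseteq> W"
proof (rule components_maximal[OF assms(3)])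
  show "connected (- cball c R)"
    by (intro connected_complement_bounded_convex assms) auto
  show "W \<inter> - cball c R \<noteq> {}"
    using assms(4) bounded_subset[OF bounded_cball, of W c R] by auto
qed (use assms in auto)

text \<open>The point 0 stands for infinity: \<open>N\<close> contains a neighbourhood of infinity,
  which inversion turns into a disc about 0. Away from 0 the inversion is continuous.\<close>

lemma open_inversion:
  fixes N :: "complex set"
  assumes "open N" "- cball c R \<subseteq> N"
  shows "open {w. w = 0 \<or> c + inverse w \<in> N}"
proof -
  \<comment> \<open>From \<open>cmod w < r\<close> follows
    \<open>cmod (inverse w) > \<bar>R\<bar> + 1 > R\<close>; the absolute value makes this work for
    any sign of \<open>R\<close>.\<close>
  define r where "r = inverse (\<bar>R\<bar> + 1)"
  have r: "r > 0" by (simp add: r_def)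
  have "open ({w. c + inverse w \<in> N} \<inter> (- {0}))"
    using continuous_open_preimage[of "- {0}" "\<lambda>w. c + inverse w" N] assms(1)
    by (simp add: continuous_on_inverse continuous_intros vimage_def Int_commute)
  moreover have "{w. w = 0 \<or> c + inverse w \<in> N} = ({w. c + inverse w \<in> N} \<inter> (- {0})) \<union> ball 0 r"
  proof -
    have "w = 0 \<or> c + inverse w \<in> N" if "w \<in> ball 0 r" for w
    proof (cases "w = 0")
      case False
      then have "cmod w < r" "cmod w > 0" using that by auto
      then have "inverse r < cmod (inverse w)"
        using less_imp_inverse_less[of "cmod w" r] by (simp only: norm_inverse)
      then have "R < cmod (inverse w)" by (simp add: r_def)
      then have "c + inverse w \<in> - cball c R" by (simp add: dist_norm)
      then show ?thesis using assms(2) by blast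
    qed auto
    moreover have "(0::complex) \<in> ball 0 r" using r by simp
    ultimately show ?thesis by blast
  qed
  ultimately show ?thesis by (metis open_Un open_ball)
qed

section \<open>The filled union of discs\<close>

theorem unbounded_complement_component_disc:
  fixes V :: "'i \<Rightarrow> complex set" and W :: "complex set"
  assumes I: "finite I" "I \<noteq> {}"
    and disc: "\<And>i. i \<in> I \<Longrightarrow> V i homeomorphic cball (0::complex) 1"
    and conn: "connected (\<Union>i\<in>I. interior (V i))"
    and W: "W \<in> components (- (\<Union>i\<in>I. V i))" and unb: "\<not> bounded W"
  shows "- W homeomorphic cball (0::complex) 1"
proof -
  define K where "K = (\<Union>i\<in>I. V i)"
  define U where "U = (\<Union>i\<in>I. interior (V i))"
  have cV: "compact (V i)" if "i \<in> I" for i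
    using homeomorphic_compactness[OF disc[OF that]] by simp
  have lV: "locally connected (V i)" if "i \<in> I" for i
    using homeomorphic_locally_connected[OF disc[OF that]] by (simp add: convex_imp_locally_connected)
  have cK: "compact K" unfolding K_def using I cV by (intro compact_UN) auto
  then have clK: "closed K" by (rule compact_imp_closed)
  have lK: "locally connected K" unfolding K_def
    using I cV lV compact_imp_closed by (intro locally_connected_finite_closed_UN) auto
  have U: "open U" "connected U" "U \<subseteq> K" using conn interior_subset by (auto simp: U_def K_def)
  have KU: "K \<subseteq> closure U"
  proof -
    have "V i \<subseteq> closure U" if "i \<in> I" for i
    proof -
      have "V i \<subseteq> closure (interior (V i))" by (rule homeomorphic_disc_subset_closure_interior[OF disc[OF that]])
      also have "\<dots> \<subseteq> closure U" using that by (intro closure_mono) (auto simp: U_def)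
      finally show ?thesis .
    qed
    then show ?thesis by (auto simp: K_def)
  qed
  \<comment> \<open>Needed for one deleted point, the centre \<open>c\<close> of inversion, and for
    two, \<open>c\<close> together with the preimage of a point of the inverted set.\<close>
  have KF: "connected (K - F)" if "finite F" for F
    using connected_diff_finite_dense[OF U(1,2) _ that U(3) KU] by simp
  have "K \<noteq> {}"
  proof -
    obtain i where i: "i \<in> I" using I by auto
    have "V i \<noteq> {}" using homeomorphic_empty(1) disc[OF i] by fastforce
    then show ?thesis using i by (auto simp: K_def)
  qed
  then have "U \<noteq> {}" using KU by auto
  then obtain c where cU: "c \<in> U" by auto
  obtain r where r: "r > 0" "cball c r \<subseteq> U" using U(1) cU open_contains_cball by blast
  have cinK: "c \<in> K" using U(3) cU by auto
  obtain R where R: "K \<subseteq> cball c R"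
    using bounded_subset_ballD[OF compact_imp_bounded[OF cK], of c] ball_subset_cball by (meson order_trans)
  have W': "W \<in> components (- K)" using W by (simp add: K_def)
  have RW: "- cball c R \<subseteq> W" by (rule subset_unbounded_component[OF _ R W' unb]) simp
  have WK: "W \<subseteq> - K" by (rule in_components_subset[OF W'])
  have oW: "open W" by (rule open_components[OF _ W']) (use clK in auto)
  have cW: "connected W" by (rule in_components_connected[OF W'])
  have fW: "frontier W \<subseteq> K" by (rule frontier_of_components_closed_complement[OF clK W'])
  have cfW: "c \<notin> frontier W"
  proof
    assume "c \<in> frontier W"
    then have "c \<in> closure W" unfolding frontier_def by (rule DiffD1)
    then have "U \<inter> closure W \<noteq> {}" using cU by blast
    then have "U \<inter> W \<noteq> {}" by (simp only: open_Int_closure_eq_empty[OF U(1)] not_False_eq_True)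
    then show False using WK U(3) by blast
  qed
  \<comment> \<open>Since \<open>inverse 0 = 0\<close>, also \<open>\<iota> c = 0\<close> and
    \<open>j 0 = c\<close>, so the two maps are mutually inverse on the whole plane.\<close>
  define \<iota> where "\<iota> = (\<lambda>z. inverse (z - c))"
  define j where "j = (\<lambda>w. c + inverse w)"
  have j\<iota>: "j (\<iota> z) = z" for z by (simp add: j_def \<iota>_def)
  have \<iota>j: "\<iota> (j w) = w" for w by (simp add: j_def \<iota>_def)
  have \<iota>0: "\<iota> z \<noteq> 0" if "z \<noteq> c" for z using that by (simp add: \<iota>_def)
  have jc: "j w \<noteq> c" if "w \<noteq> 0" for w using that by (simp add: j_def)
  have c\<iota>: "continuous_on A \<iota>" if "c \<notin> A" for A unfolding \<iota>_def
    using that by (intro continuous_intros) auto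
  have cj: "continuous_on A j" if "0 \<notin> A" for A unfolding j_def
    using that by (intro continuous_intros) auto
  have hom: "homeomorphism A (\<iota> ` A) \<iota> j" if "c \<notin> A" for A
  proof -
    have "0 \<notin> \<iota> ` A" using that \<iota>0 by force
    then show ?thesis unfolding homeomorphism_def
      using that by (auto simp: j\<iota> \<iota>j c\<iota> cj image_image)
  qed
  \<comment> \<open>The image of \<open>W\<close> together with infinity. The point 0 is added by
    hand because \<open>j 0 = c\<close> lies in \<open>K\<close>, not in \<open>W\<close>.\<close>
  define G where "G = {w. w = 0 \<or> j w \<in> W}"
  define K' where "K' = \<iota> ` (K - {c})"
  have K'_iff: "w \<in> K' \<longleftrightarrow> w \<noteq> 0 \<and> j w \<in> K" for w
  proof
    assume "w \<in> K'"
    then show "w \<noteq> 0 \<and> j w \<in> K" using \<iota>0 by (auto simp: K'_def j\<iota>)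
  next
    assume w: "w \<noteq> 0 \<and> j w \<in> K"
    then have "w = \<iota> (j w)" "j w \<in> K - {c}" using jc by (auto simp: \<iota>j)
    then show "w \<in> K'" unfolding K'_def by (rule image_eqI)
  qed
  have cnW: "c \<notin> W" using WK cinK by auto
  have oG: "open G" unfolding G_def j_def by (rule open_inversion[OF oW RW])
  have clK': "closed K'"
  proof -
    have "open {w. w = 0 \<or> j w \<in> - K}" unfolding j_def
      by (rule open_inversion[of _ c R]) (use clK R in auto)
    moreover have "- K' = {w. w = 0 \<or> j w \<in> - K}" using K'_iff by auto
    ultimately show ?thesis by (simp add: closed_def)
  qed
  have G_eq: "G = insert 0 (\<iota> ` W)"
  proof -
    have "w \<in> \<iota> ` W" if "j w \<in> W" for w using image_eqI[of w \<iota> "j w" W] that by (simp add: \<iota>j)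
    then show ?thesis by (auto simp: G_def j\<iota>)
  qed
  have con\<iota>W: "connected (\<iota> ` W)" by (intro connected_continuous_image c\<iota> cnW cW)
  have cG: "connected G"
  proof (rule connected_intermediate_closure[OF con\<iota>W])
    have "0 islimpt G" using oG by (intro interior_limit_point) (simp add: interior_open G_def)
    then have "0 islimpt \<iota> ` W" unfolding G_eq by (simp add: islimpt_insert)
    then show "G \<subseteq> closure (\<iota> ` W)" using closure_subset[of "\<iota> ` W"] by (auto simp: G_eq closure_def)
  qed (auto simp: G_eq)
  have bG: "bounded G"
  proof -
    have "cmod w \<le> inverse r" if "w \<in> \<iota> ` W" for w
    proof -
      obtain z where z: "z \<in> W" "w = \<iota> z" using \<open>w \<in> \<iota> ` W\<close> by auto
      then have "z \<notin> cball c r" using WK U(3) r(2) by blast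
      then have "r < cmod (z - c)" by (simp add: dist_norm norm_minus_commute)
      then have "inverse (cmod (z - c)) \<le> inverse r" using r(1) by (intro le_imp_inverse_le) auto
      then show ?thesis by (simp add: z(2) \<iota>_def norm_inverse)
    qed
    then have "bounded (\<iota> ` W)" unfolding bounded_iff by blast
    then show ?thesis by (simp add: G_eq)
  qed
  have nG: "- G = \<iota> ` (- {c} - W)"
  proof
    show "- G \<subseteq> \<iota> ` (- {c} - W)"
    proof
      fix w assume "w \<in> - G"
      then have "j w \<in> - {c} - W" using jc by (auto simp: G_def)
      then show "w \<in> \<iota> ` (- {c} - W)" by (intro image_eqI[of _ _ "j w"]) (simp add: \<iota>j)
    qed
    show "\<iota> ` (- {c} - W) \<subseteq> - G" using \<iota>0 by (auto simp: G_def j\<iota>)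
  qed
  have conn_nG: "connected (- G)" unfolding nG
  proof (intro connected_continuous_image c\<iota>)
    \<comment> \<open>Inside the connected set \<open>- {c}\<close>, removing a complementary
      component of the connected set \<open>K - {c}\<close> leaves a connected set.\<close>
    have "- {c} - (K - {c}) = - K" using cinK by blast
    then have Wc: "W \<in> components (- {c} - (K - {c}))" using W' by simp
    show "connected (- {c} - W)"
    proof (rule component_diff_connected[OF _ _ _ Wc])
      show "connected (K - {c})" by (intro KF) simp
      show "connected (- {c})" by (intro connected_punctured_universe) simp
    qed blast
  qed simp
  have unb_nG: "\<not> bounded (- G)"
  proof
    assume "bounded (- G)"
    then obtain B where B: "\<And>w. w \<in> - G \<Longrightarrow> cmod w \<le> B" unfolding bounded_iff by blast
    \<comment> \<open>The point \<open>c + 1/b\<close> lies in the disc \<open>cball c r\<close>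
      inside \<open>K\<close>, so it is outside \<open>W\<close>, and \<iota> sends it to
      \<open>b\<close>, beyond the supposed bound \<open>B\<close>.\<close>
    define b where "b = max B (inverse r) + 1"
    have ir: "inverse r > 0" using r(1) by simp
    have b: "b > B" "b > inverse r" "b > 0" using ir unfolding b_def by linarith+
    have "inverse b < r" using less_imp_inverse_less[OF b(2) ir] by simp
    then have "c + of_real (inverse b) \<in> cball c r" using b(3) by (simp add: dist_norm norm_inverse)
    then have "c + of_real (inverse b) \<in> - {c} - W" using r(2) U(3) WK b(3) by fastforce
    then have "of_real b \<in> - G" unfolding nG by (intro image_eqI[of _ _ "c + of_real (inverse b)"]) (simp add: \<iota>_def)
    then show False using B[of "of_real b"] b by simp
  qed
  \<comment> \<open>The only component of \<open>- G\<close> is \<open>- G\<close> itself, which is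
    unbounded; for a connected open plane set this gives simple connectedness.\<close>
  have scG: "simply_connected G"
  proof -
    have "components (- G) \<subseteq> {- G}"
      using conn_nG by (metis bot.extremum components_empty components_eq_sing_iff order_refl)
    then show ?thesis
      using simply_connected_eq_unbounded_complement_components[OF oG] cG unb_nG by blast
  qed
  have fr_iff: "\<iota> z \<in> frontier G \<longleftrightarrow> z \<in> frontier W" if zc: "z \<noteq> c" for z
  proof -
    have "\<iota> z \<in> G \<longleftrightarrow> z \<in> W" using \<iota>0[OF zc] by (simp add: G_def j\<iota>)
    moreover have "\<iota> z \<in> closure G" if zW: "z \<in> closure W"
    proof -
      obtain x where x: "\<And>n. x n \<in> W" "x \<longlonglongrightarrow> z" using zW unfolding closure_sequential by blast
      have "(\<lambda>n. \<iota> (x n)) \<longlonglongrightarrow> \<iota> z" unfolding \<iota>_def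
        using x(2) zc by (intro tendsto_intros) auto
      moreover have "\<iota> (x n) \<in> G" for n using x(1) by (simp add: G_eq)
      ultimately show ?thesis unfolding closure_sequential by (intro exI[of _ "\<lambda>n. \<iota> (x n)"]) simp
    qed
    moreover have "z \<in> closure W" if zG: "\<iota> z \<in> closure G"
    proof -
      have "closure G = insert 0 (closure (\<iota> ` W))"
        using closure_Un[of "{0}" "\<iota> ` W"] by (simp add: G_eq)
      then have "\<iota> z \<in> closure (\<iota> ` W)" using zG \<iota>0[OF zc] by simp
      then obtain x where x: "\<And>n. x n \<in> \<iota> ` W" "x \<longlonglongrightarrow> \<iota> z" unfolding closure_sequential by blast
      have "(\<lambda>n. j (x n)) \<longlonglongrightarrow> j (\<iota> z)" unfolding j_def
        using x(2) \<iota>0[OF zc] by (intro tendsto_intros) auto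
      moreover have "j (x n) \<in> W" for n using x(1)[of n] by (auto simp: j\<iota>)
      ultimately show ?thesis unfolding closure_sequential by (intro exI[of _ "\<lambda>n. j (x n)"]) (simp add: j\<iota>)
    qed
    ultimately show ?thesis using oG oW by (auto simp: frontier_def interior_open)
  qed
  have zfG: "0 \<notin> frontier G" using oG by (simp add: frontier_def interior_open G_def)
  have fG: "frontier G = \<iota> ` frontier W"
  proof
    show "\<iota> ` frontier W \<subseteq> frontier G"
      unfolding image_subset_iff using fr_iff cfW by metis
    show "frontier G \<subseteq> \<iota> ` frontier W"
    proof
      fix w assume w: "w \<in> frontier G"
      then have "w \<noteq> 0" using zfG by auto
      then have "j w \<in> frontier W" using fr_iff[of "j w"] jc w by (simp add: \<iota>j)
      then show "w \<in> \<iota> ` frontier W" by (intro image_eqI[of _ _ "j w"]) (simp add: \<iota>j)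
    qed
  qed
  have fGK: "frontier G \<subseteq> K'" unfolding fG K'_def using fW cfW by auto
  have GK: "G \<inter> K' = {}" using WK by (auto simp: K'_iff G_def)
  have lK': "locally connected K'"
  proof -
    have "openin (top_of_set K) (K - {c})" by (simp add: openin_delete)
    then have "locally connected (K - {c})" using lK locally_open_subset by blast
    moreover have "K - {c} homeomorphic K'" unfolding K'_def homeomorphic_def using hom[of "K - {c}"] by blast
    ultimately show ?thesis using homeomorphic_locally_connected by blast
  qed
  have K'p: "connected (K' - {p})" for p
  proof -
    \<comment> \<open>Deleting a point of the inverted set amounts to deleting two points of
      \<open>K\<close>, as \<open>c\<close> has already gone to infinity.\<close>
    have "K' - {p} = \<iota> ` (K - {c, j p})"
    proof
      show "K' - {p} \<subseteq> \<iota> ` (K - {c, j p})"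
      proof
        fix w assume "w \<in> K' - {p}"
        then have "j w \<in> K - {c, j p}" using jc K'_iff \<iota>j by (metis Diff_iff insert_iff singletonD singletonI)
        then show "w \<in> \<iota> ` (K - {c, j p})" by (intro image_eqI[of _ _ "j w"]) (simp add: \<iota>j)
      qed
      show "\<iota> ` (K - {c, j p}) \<subseteq> K' - {p}" unfolding K'_def using j\<iota> by auto
    qed
    moreover have "connected (\<iota> ` (K - {c, j p}))"
      by (intro connected_continuous_image c\<iota> KF) auto
    ultimately show ?thesis by simp
  qed
  have "G \<noteq> {}" by (auto simp: G_def)
  then obtain h :: "complex \<Rightarrow> complex" where h: "continuous_on (cball 0 1) h" "inj_on h (cball 0 1)"
      "h ` sphere 0 1 = frontier G"
    using Caratheodory_extension[OF oG bG scG _ clK' fGK GK lK' K'p] by metis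
  \<comment> \<open>The boundary circle is carried to the frontier of \<open>G\<close> and inverted
    back, which exhibits the frontier of \<open>W\<close> as a Jordan curve.\<close>
  define \<gamma> where "\<gamma> = (j \<circ> h) \<circ> circlepath 0 1"
  have pic: "path_image (circlepath 0 1) = sphere (0::complex) 1" by simp
  have injj: "inj_on j A" for A using \<iota>j by (metis inj_on_inverseI)
  have \<gamma>: "simple_path \<gamma>" unfolding \<gamma>_def
  proof (rule simple_path_continuous_image)
    show "simple_path (circlepath 0 1)" by (simp add: simple_path_circlepath)
    show "continuous_on (path_image (circlepath 0 1)) (j \<circ> h)" unfolding pic
      by (intro continuous_on_compose continuous_on_subset[OF h(1)] cj) (use h(3) zfG in auto)
    show "inj_on (j \<circ> h) (path_image (circlepath 0 1))" unfolding pic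
      by (intro comp_inj_on injj inj_on_subset[OF h(2)]) auto
  qed
  have \<gamma>loop: "pathfinish \<gamma> = pathstart \<gamma>"
    by (simp add: \<gamma>_def pathfinish_compose pathstart_compose)
  have "path_image \<gamma> = j ` h ` sphere 0 1" by (simp only: \<gamma>_def path_image_compose pic image_comp)
  also have "\<dots> = frontier W" unfolding h(3) fG by (simp add: image_image j\<iota>)
  finally have \<gamma>W: "path_image \<gamma> = frontier W" .
  note J = Jordan_inside_outside[OF \<gamma> \<gamma>loop, unfolded \<gamma>W]
  have WJ: "W \<inter> frontier W = {}" using oW by (auto simp: frontier_def interior_open)
  \<comment> \<open>Being unbounded, \<open>W\<close> cannot lie in the inside of its frontier.
    \<open>W\<close> and the outside are connected, meet, and avoid the frontier, so they
    coincide.\<close>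
  have meet: "W \<inter> outside (frontier W) \<noteq> {}"
  proof
    assume "W \<inter> outside (frontier W) = {}"
    then have "W \<subseteq> inside (frontier W)" using J WJ by blast
    then show False using J unb bounded_subset by blast
  qed
  have "W = outside (frontier W)"
  proof
    show "W \<subseteq> outside (frontier W)"
      using connected_Int_frontier[OF cW meet] J WJ by auto
    show "outside (frontier W) \<subseteq> W"
      using connected_Int_frontier[of "outside (frontier W)" W] J meet outside_no_overlap[of "frontier W"] by blast
  qed
  then have "- W = frontier W \<union> inside (frontier W)" using J by blast
  also have "\<dots> = closure (inside (frontier W))"
    using J closure_Un_frontier[of "inside (frontier W)"] by auto
  finally show ?thesis
    using closure_inside_simple_loop_homeomorphic_disc[OF \<gamma> \<gamma>loop] \<gamma>W by simp
qed

section \<open>Transfer from the complex plane to \<open>real^2\<close>\<close>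

theorem theorem1:
  fixes n :: nat and V :: "nat \<Rightarrow> (real^2) set" and W :: "(real^2) set"
  assumes "n \<ge> 1"
    and "\<And>i. i \<in> {1..n} \<Longrightarrow> closed (V i)"
    and "\<And>i. i \<in> {1..n} \<Longrightarrow> V i homeomorphic cball (0::real^2) 1"
    and "connected (\<Union>i\<in>{1..n}. interior (V i))"
    and "W \<in> components (UNIV - (\<Union>i\<in>{1..n}. V i))"
    and "\<not> bounded W"
  shows "(UNIV - W) homeomorphic cball (0::real^2) 1"
proof -
  \<comment> \<open>\<open>C\<close> and \<open>R\<close> are mutually inverse linear isometries, so
    they carry discs, interiors, components and boundedness from one plane to the other.\<close>
  define C where "C = (\<lambda>v::real^2. Complex (v$1) (v$2))"
  define R where "R = (\<lambda>z. vector [Re z, Im z] :: real^2)"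
  have CR: "C (R z) = z" for z by (simp add: C_def R_def)
  have RC: "R (C v) = v" for v by (simp add: C_def R_def vec_eq_iff forall_2)
  have lC: "linear C" unfolding C_def
    by (intro linearI) (auto simp: complex_eq_iff)
  have lR: "linear R" unfolding R_def
    by (intro linearI) (auto simp: vec_eq_iff forall_2)
  have bij: "bij C" by (rule bijI') (metis RC, metis CR)
  have cC: "continuous_on S C" and cR: "continuous_on T R" for S T
    using lC lR by (simp_all add: linear_continuous_on linear_conv_bounded_linear)
  have hom: "S homeomorphic C ` S" for S
    unfolding homeomorphic_def homeomorphism_def
    by (intro exI[of _ C] exI[of _ R]) (simp add: CR RC cC cR image_image)
  have nC: "cmod (C v) = norm v" for v
    by (simp add: C_def cmod_def norm_vec_def L2_set_def UNIV_2)
  have ball: "C ` cball 0 1 = cball 0 1"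
  proof
    show "C ` cball 0 1 \<subseteq> cball 0 1" by (auto simp: nC)
    show "cball 0 1 \<subseteq> C ` cball 0 1"
    proof
      fix z :: complex assume "z \<in> cball 0 1"
      then have "R z \<in> cball 0 1" using nC[of "R z"] by (simp add: CR)
      then show "z \<in> C ` cball 0 1" by (intro image_eqI[of _ _ "R z"]) (simp_all add: CR)
    qed
  qed
  have disc: "cball (0::real^2) 1 homeomorphic cball (0::complex) 1"
    using hom[of "cball 0 1"] unfolding ball .
  have compl: "C ` (UNIV - S) = - (C ` S)" for S
    using bij_image_Compl_eq[OF bij, of S] by (simp add: Compl_eq_Diff_UNIV)
  have "- (C ` W) homeomorphic cball (0::complex) 1"
  proof (rule unbounded_complement_component_disc[of "{1..n}" "\<lambda>i. C ` V i"])
    show "C ` V i homeomorphic cball (0::complex) 1" if "i \<in> {1..n}" for i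
      using hom[of "V i"] assms(3)[OF that] disc homeomorphic_sym homeomorphic_trans by meson
    have "(\<Union>i\<in>{1..n}. interior (C ` V i)) = C ` (\<Union>i\<in>{1..n}. interior (V i))"
      by (simp add: interior_bijective_linear_image[OF lC bij] image_UN)
    then show "connected (\<Union>i\<in>{1..n}. interior (C ` V i))"
      using connected_continuous_image[OF cC assms(4)] by simp
    have eq: "- (\<Union>i\<in>{1..n}. C ` V i) = C ` (UNIV - (\<Union>i\<in>{1..n}. V i))"
      by (simp only: compl image_UN)
    note W = assms(5)[unfolded in_components_maximal]
    show "C ` W \<in> components (- (\<Union>i\<in>{1..n}. C ` V i))"
      unfolding eq in_components_maximal
    proof (intro conjI allI impI)
      show "C ` W \<noteq> {}" using W by blast
      show "C ` W \<subseteq> C ` (UNIV - (\<Union>i\<in>{1..n}. V i))" using W by (intro image_mono) blast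
      show "connected (C ` W)" using W by (intro connected_continuous_image cC) simp
      fix D assume D: "D \<noteq> {} \<and> C ` W \<subseteq> D \<and> D \<subseteq> C ` (UNIV - (\<Union>i\<in>{1..n}. V i)) \<and> connected D"
      then have "W \<subseteq> R ` D" using image_mono[of "C ` W" D R] by (simp add: image_image RC)
      moreover have "R ` D \<subseteq> UNIV - (\<Union>i\<in>{1..n}. V i)"
        using D image_mono[of D "C ` (UNIV - (\<Union>i\<in>{1..n}. V i))" R] by (simp add: image_image RC)
      moreover have "connected (R ` D)" using D by (intro connected_continuous_image cR) simp
      ultimately have "R ` D = W" using W D by auto
      then show "D = C ` W" by (auto simp: image_image CR)
    qed
    show "\<not> bounded (C ` W)"
    proof
      assume "bounded (C ` W)"
      then have "bounded (R ` (C ` W))"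
        by (rule bounded_linear_image) (use lR in \<open>simp add: linear_conv_bounded_linear\<close>)
      then show False using assms(6) by (simp add: image_image RC)
    qed
  qed (use assms(1) in auto)
  then have "C ` (UNIV - W) homeomorphic cball (0::complex) 1" unfolding compl .
  then show ?thesis using hom[of "UNIV - W"] disc homeomorphic_sym homeomorphic_trans by meson
qed

end
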